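(* Let $K$ be a finite field with $q$ elements and let $n\in3\mathbb{N}_{>0}$. Then \[ |C_3^*(n)|=\frac{q^{2n}+3f(q)q^{\frac43n}+(q^5-3q^4-2q^3+5q^2+9q+6)q^n+3f(q)q^{\frac23n+1}+q^3}{(q-1)^2}, \] where $f(q)=q^3-q^2-q-2$.
   Context: $C_3(n)$ is the set of tuples $(v_1,\dots,v_n)\in(\mathbb{P}^2(K))^n$ such that for every $i\in\{1,\dots,n\}$ the points $v_i,v_{i+1},v_{i+2}$ (indices mod $n$) are projectively independent. For $3\mid n$, $C_3^*(n)$ is the set of $(v_1,\dots,v_n)\in C_3(n)$ such that, for a (any) lift $(V_1,\dots,V_n)$ in $K^3$ and $d_i=\det(V_i,V_{i+1},V_{i+2})$ (indices mod $n$), one has $d_id_{i+3}\cdots d_{i+n-3}=d_{i+1}d_{i+4}\cdots d_{i+n-2}$ for $i=1$ and $i=2$. *)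

theory Defs
  imports "HOL-Analysis.Determinants" "HOL-Analysis.Cartesian_Euclidean_Space"
begin

definition proj_plane :: "('k::field ^ 3) set set" where
  "proj_plane = {p. vec.subspace p \<and> vec.dim p = 1}"

definition is_lift :: "'k::field ^ 3 \<Rightarrow> ('k ^ 3) set \<Rightarrow> bool" where
  "is_lift V p \<longleftrightarrow> V \<in> p \<and> V \<noteq> 0"

text \<open>Independence of a family of points (with multiplicities, hence \<open>distinct\<close>): some lift to
  vectors is linearly independent. By \<open>proj_independent_iff\<close> below the lift is immaterial.\<close>

definition proj_independent :: "('k::field ^ 3) set list \<Rightarrow> bool" where
  "proj_independent ps \<longleftrightarrow>
     (\<exists>Us. list_all2 is_lift Us ps \<and> distinct Us \<and> vec.independent (set Us))"

text \<open>The entry with 1-based index \<open>i \<ge> 1\<close> of a tuple, indices being read modulo its length.\<close>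

definition cyc :: "'a list \<Rightarrow> nat \<Rightarrow> 'a" where
  "cyc xs i = xs ! ((i - 1) mod length xs)"

definition C3 :: "nat \<Rightarrow> ('k::field ^ 3) set list set" where
  "C3 n = {vs. length vs = n \<and> set vs \<subseteq> proj_plane \<and>
     (\<forall>i\<in>{1..n}. proj_independent [cyc vs i, cyc vs (i + 1), cyc vs (i + 2)])}"

definition cyc_det :: "('k::field ^ 3) list \<Rightarrow> nat \<Rightarrow> 'k" where
  "cyc_det Vs i = det (vector [cyc Vs i, cyc Vs (i + 1), cyc Vs (i + 2)] :: 'k ^ 3 ^ 3)"

definition balanced :: "('k::field ^ 3) list \<Rightarrow> bool" where
  "balanced Vs \<longleftrightarrow> (\<forall>i\<in>{1, 2}.
     (\<Prod>j<length Vs div 3. cyc_det Vs (i + 3 * j)) =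
     (\<Prod>j<length Vs div 3. cyc_det Vs (i + 1 + 3 * j)))"

text \<open>For \<open>3 dvd n\<close> it does not matter which lift is taken, see \<open>C3_star_any_lift\<close> below.\<close>

definition C3_star :: "nat \<Rightarrow> ('k::field ^ 3) set list set" where
  "C3_star n = {vs \<in> C3 n. \<exists>Vs. list_all2 is_lift Vs vs \<and> balanced Vs}"

lemma is_lift_scale:
  assumes "p \<in> proj_plane" "is_lift V p" "is_lift W p"
  shows "\<exists>c. c \<noteq> 0 \<and> W = c *s V"
proof -
  have V: "V \<in> p" "V \<noteq> 0" and W: "W \<in> p" "W \<noteq> 0" and p: "vec.dim p = 1"
    using assms by (auto simp: is_lift_def proj_plane_def)
  have "p \<subseteq> vec.span {V}"
    by (rule vec.card_ge_dim_independent) (use V p in auto)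
  then obtain c where "W = c *s V"
    using W by (auto simp: vec.span_singleton)
  then show ?thesis using W by auto
qed

lemma lifts_scale:
  assumes "set vs \<subseteq> proj_plane" "list_all2 is_lift Vs vs" "list_all2 is_lift Ws vs"
  obtains c where "\<And>k. k < length vs \<Longrightarrow> c k \<noteq> 0 \<and> Ws ! k = c k *s (Vs ! k)"
proof -
  have "\<forall>k. \<exists>c. k < length vs \<longrightarrow> c \<noteq> 0 \<and> Ws ! k = c *s (Vs ! k)"
    using assms is_lift_scale by (metis list_all2_nthD2 nth_mem subset_iff)
  then show ?thesis using that by metis
qed

lemma balanced_scale:
  assumes n: "3 dvd n" "n > 0" "length Vs = n" "length Ws = n"
    and c: "\<And>k. k < n \<Longrightarrow> c k \<noteq> 0 \<and> Ws ! k = c k *s (Vs ! k)"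
    and "balanced Vs"
  shows "balanced Ws"
proof -
  define e where "e i = c ((i - 1) mod n)" for i
  have W: "cyc Ws i = e i *s cyc Vs i" for i
    using c[of "(i - 1) mod n"] n by (simp add: cyc_def e_def)
  have d: "cyc_det Ws i = (e i * e (i + 1) * e (i + 2)) * cyc_det Vs i" for i
    by (simp add: cyc_det_def W det_3 vector_3 algebra_simps)
  have s: "(\<Prod>j<n div 3. e (i + 3 * j) * e (i + 3 * j + 1) * e (i + 3 * j + 2)) = (\<Prod>k<n. e (i + k))" for i
  proof -
    have "(\<Prod>j<m. e (i + 3 * j) * e (i + 3 * j + 1) * e (i + 3 * j + 2)) = (\<Prod>k<3 * m. e (i + k))" for m
      by (induction m) (simp_all add: algebra_simps eval_nat_numeral)
    from this[of "n div 3"] show ?thesis using n by simp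
  qed
  have shift: "(\<Prod>k<n. e (Suc i + k)) = (\<Prod>k<n. e (i + k))" if "i \<ge> 1" for i
  proof -
    have "e (i + n) = e i"
      using that by (cases i) (auto simp: e_def)
    moreover have "e i * (\<Prod>k<n. e (Suc i + k)) = (\<Prod>k<Suc n. e (i + k))"
      by (subst prod.lessThan_Suc_shift) simp
    moreover have "e i \<noteq> 0" using c n by (simp add: e_def)
    ultimately show ?thesis by simp
  qed
  have P: "(\<Prod>j<n div 3. cyc_det Ws (i + 3 * j)) =
      (\<Prod>k<n. e (i + k)) * (\<Prod>j<n div 3. cyc_det Vs (i + 3 * j))" for i
    by (simp add: d prod.distrib flip: s)
  show ?thesis
    unfolding balanced_def
  proof
    fix i :: nat assume i: "i \<in> {1, 2}"
    then have "(\<Prod>k<n. e (i + 1 + k)) = (\<Prod>k<n. e (i + k))" using shift[of i] by auto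
    moreover have "(\<Prod>j<n div 3. cyc_det Vs (i + 3 * j)) = (\<Prod>j<n div 3. cyc_det Vs (i + 1 + 3 * j))"
      using \<open>balanced Vs\<close> i n unfolding balanced_def by auto
    ultimately show "(\<Prod>j<length Ws div 3. cyc_det Ws (i + 3 * j)) =
        (\<Prod>j<length Ws div 3. cyc_det Ws (i + 1 + 3 * j))"
      using P[of i] P[of "i + 1"] n by simp
  qed
qed

lemma lift_exists:
  assumes "set vs \<subseteq> proj_plane"
  shows "\<exists>Vs. list_all2 is_lift Vs vs"
  using assms
proof (induction vs)
  case (Cons p vs)
  then have "vec.dim p = 1" by (auto simp: proj_plane_def)
  then have "\<not> p \<subseteq> {0}"
    using vec.dim_eq_0[of p] by auto
  then obtain V where "is_lift V p" by (auto simp: is_lift_def)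
  with Cons show ?case by (auto intro!: list_all2_Cons[THEN iffD2])
qed simp

lemma C3_star_any_lift:
  assumes "3 dvd n" "n > 0"
  shows "C3_star n = {vs \<in> C3 n. \<forall>Vs. list_all2 is_lift Vs vs \<longrightarrow> balanced Vs}"
proof -
  have "balanced Ws" if h: "vs \<in> C3 n" "list_all2 is_lift Vs vs" "list_all2 is_lift Ws vs" "balanced Vs"
    for vs Vs Ws :: "_ list"
  proof -
    have *: "set vs \<subseteq> proj_plane" "length vs = n" using h by (auto simp: C3_def)
    obtain c where "\<And>k. k < length vs \<Longrightarrow> c k \<noteq> 0 \<and> Ws ! k = c k *s (Vs ! k)"
      using lifts_scale[OF *(1) h(2,3)] by blast
    then show ?thesis
      using balanced_scale[OF assms _ _ _ h(4), of Ws c] * h by (auto dest: list_all2_lengthD)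
  qed
  moreover have "\<exists>Vs. list_all2 is_lift Vs vs" if "vs \<in> C3 n" for vs
    using lift_exists that by (auto simp: C3_def)
  ultimately show ?thesis unfolding C3_star_def by blast
qed

lemma proj_independent_iff:
  assumes "set ps \<subseteq> proj_plane" "list_all2 is_lift Vs ps"
  shows "proj_independent ps \<longleftrightarrow> distinct Vs \<and> vec.independent (set Vs)"
proof
  assume "proj_independent ps"
  then obtain Us where U: "list_all2 is_lift Us ps" "distinct Us" "vec.independent (set Us)"
    by (auto simp: proj_independent_def)
  obtain c where c: "\<And>k. k < length ps \<Longrightarrow> c k \<noteq> 0 \<and> Us ! k = c k *s (Vs ! k)"
    using lifts_scale[OF assms U(1)] by blast
  have len: "length Us = length ps" "length Vs = length ps"
    using U assms by (auto dest: list_all2_lengthD)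
  have "set Us \<subseteq> vec.span (set Vs)"
  proof
    fix u assume "u \<in> set Us"
    then obtain k where "k < length ps" "u = Us ! k" using len by (auto simp: in_set_conv_nth)
    then show "u \<in> vec.span (set Vs)" using c[of k] len by (metis nth_mem \<open>u = Us ! k\<close> vec.span_base vec.span_scale)
  qed
  then have "vec.dim (set Us) \<le> vec.dim (set Vs)"
    by (metis vec.dim_span vec.dim_subset)
  moreover have "vec.dim (set Us) = length ps"
    using U len by (simp add: vec.dim_eq_card_independent distinct_card)
  moreover have "vec.dim (set Vs) \<le> card (set Vs)" by (rule vec.dim_le_card') simp
  moreover have "card (set Vs) \<le> length ps" using card_length[of Vs] len by simp
  ultimately have "card (set Vs) = length Vs" "vec.dim (set Vs) = card (set Vs)" using len by auto
  then show "distinct Vs \<and> vec.independent (set Vs)"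
    using vec.card_le_dim_spanning[of "set Vs" "vec.span (set Vs)"]
    by (auto intro!: card_distinct simp: vec.span_superset)
next
  assume "distinct Vs \<and> vec.independent (set Vs)"
  then show "proj_independent ps" using assms by (auto simp: proj_independent_def)
qed

end

theory Submission
  imports Defs
begin

text \<open>
  Scaling the lifts changes the determinants \<open>d\<^sub>i\<close> by \<open>c\<^sub>i c\<^sub>i\<^sub>+\<^sub>1 c\<^sub>i\<^sub>+\<^sub>2\<close>, and the balance
  condition says exactly that all \<open>d\<^sub>i\<close> can be normalised to \<open>1\<close>, in \<open>(q - 1)\<^sup>2\<close> ways. For a normalised cyclic sequence \<open>V\<close> the
  pairs \<open>(V\<^sub>i, V\<^sub>i\<^sub>-\<^sub>1 \<times> V\<^sub>i)\<close> form a closed walk on the pairs \<open>(x, f)\<close> of nonzero vectors with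
  \<open>f \<cdot> x = 0\<close>; each step first replaces \<open>f\<close> by \<open>f'\<close> with \<open>f \<times> f' = x\<close>, and then \<open>x\<close> by \<open>x'\<close> with
  \<open>x \<times> x' = f'\<close>. Hence the number of normalised sequences is the trace of \<open>(S1 S2)\<^sup>n\<close>, where \<open>S1\<close>, \<open>S2\<close>
  are the adjacency matrices of the two half steps. These generate, with the torus acting by scaling
  \<open>x\<close> and \<open>f\<close>, a Yokonuma-Hecke algebra of type \<open>A\<^sub>2\<close>: they satisfy the braid relation and quadratic
  relations. So \<open>Z = (S1 S2)\<^sup>3\<close> is the full twist, which is central, and its eigenvalues are read off
  on the pieces cut out by the averaging idempotents of the three coroot subgroups of the torus:
  \<open>q\<^sup>3\<close> on the generic piece, \<open>q\<^sup>4\<close> and \<open>q\<^sup>2\<close> where one idempotent acts as the identity, and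
  \<open>q\<^sup>6\<close>, \<open>q\<^sup>3\<close>, \<open>1\<close> where all three do. The multiplicities follow from the traces of low powers
  of \<open>Z\<close> on each piece, since nontrivial reduced words have trace \<open>0\<close>.
\<close>

subsection \<open>The full twist in an algebra of type \<open>A\<^sub>2\<close>\<close>

text \<open>
  \<open>P\<close> is the unit of the Hecke algebra, which need not be the unit of the ambient ring. The \<open>t\<^sub>i\<close> are
  the values at \<open>-1\<close> of the three coroots, and the \<open>e\<^sub>i\<close> and \<open>e\<close> average over the image of a coroot
  and over the whole torus.
\<close>

locale hecke_A2 =
  fixes S1 S2 P e1 e2 e3 e t1 t2 t3 :: "'r::real_algebra_1" and tr :: "'r \<Rightarrow> real" and q N :: real
  assumes q: "q \<ge> 2"
    and braid: "S2 * (S1 * S2) = S1 * (S2 * S1)"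
    and quad1: "S1 * S1 = q *\<^sub>R t1 + (q - 1) *\<^sub>R (S1 * e1)"
    and quad2: "S2 * S2 = q *\<^sub>R t2 + (q - 1) *\<^sub>R (S2 * e2)"
    and PS: "P * S1 = S1" "S1 * P = S1" "P * S2 = S2" "S2 * P = S2"
    and PP: "P * P = P"
    and tS: "t1 * S1 = S1 * t1" "t2 * S1 = S1 * t3" "t3 * S1 = S1 * t2"
      "t2 * S2 = S2 * t2" "t1 * S2 = S2 * t3" "t3 * S2 = S2 * t1"
    and tt: "t1 * t1 = P" "t2 * t2 = P" "t3 * t3 = P"
      "t1 * t2 = t3" "t2 * t1 = t3" "t1 * t3 = t2" "t3 * t1 = t2" "t2 * t3 = t1" "t3 * t2 = t1"
    and eS: "e1 * S1 = S1 * e1" "e2 * S1 = S1 * e3" "e3 * S1 = S1 * e2" "e * S1 = S1 * e"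
      "e2 * S2 = S2 * e2" "e1 * S2 = S2 * e3" "e3 * S2 = S2 * e1" "e * S2 = S2 * e"
    and ee: "e1 * e1 = e1" "e2 * e2 = e2" "e3 * e3 = e3" "e * e = e"
      "e1 * e2 = e" "e2 * e1 = e" "e1 * e3 = e" "e3 * e1 = e" "e2 * e3 = e" "e3 * e2 = e"
      "e1 * e = e" "e2 * e = e" "e3 * e = e" "e * e1 = e" "e * e2 = e" "e * e3 = e"
    and eP: "e1 * P = e1" "e2 * P = e2" "e3 * P = e3" "e * P = e"
        "P * e1 = e1" "P * e2 = e2" "P * e3 = e3" "P * e = e"
    and te: "t1 * e1 = e1" "t2 * e2 = e2" "t3 * e3 = e3" "t1 * e = e" "t2 * e = e" "t3 * e = e"
    and et: "e1 * t1 = t1 * e1" "e2 * t1 = t1 * e2" "e3 * t1 = t1 * e3" "e * t1 = t1 * e"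
      "e1 * t2 = t2 * e1" "e2 * t2 = t2 * e2" "e3 * t2 = t2 * e3" "e * t2 = t2 * e"
      "e1 * t3 = t3 * e1" "e2 * t3 = t3 * e2" "e3 * t3 = t3 * e3" "e * t3 = t3 * e"
    and tr_add: "tr (x + y) = tr x + tr y"
    and tr_scale: "tr (c *\<^sub>R x) = c * tr x"
    and tr_cyc: "tr (x * y) = tr (y * x)"
    and tr_P: "tr P = N"
    and tr_ei: "tr e1 = N / (q - 1)" "tr e2 = N / (q - 1)" "tr e3 = N / (q - 1)"
    and tr_e: "tr e = N / (q - 1)\<^sup>2"
    and tr_e1_S1: "tr (S1 * e1) = 0"
    and tr_words: "tr (S1 * e) = 0" "tr (S2 * e) = 0" "tr (S1 * (S2 * e)) = 0"
      "tr (S2 * (S1 * e)) = 0" "tr (S1 * (S2 * (S1 * e))) = 0"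
begin

lemma tr_diff: "tr (x - y) = tr x - tr y"
  using tr_add[of x "-1 *\<^sub>R y"] tr_scale[of "-1" y] by simp

lemma mult_left_ext: "a * b = c \<Longrightarrow> a * (b * x) = c * (x :: 'r)" for a b c :: 'r
  by (simp flip: mult.assoc)

lemmas rel = PS PP tS tt eS ee eP te et
lemmas rel_ext = rel[THEN mult_left_ext]

lemma braid_ext: "S2 * (S1 * (S2 * x)) = S1 * (S2 * (S1 * x))"
  by (metis braid mult.assoc)

text \<open>
  A rewrite system with normal forms: a reduced word in \<open>S1\<close>, \<open>S2\<close>, then a torus element, then an
  idempotent.
\<close>

lemmas nf = mult.assoc braid braid_ext quad1 quad2 quad1[THEN mult_left_ext] quad2[THEN mult_left_ext] rel rel_ext
   distrib_left distrib_right left_diff_distrib right_diff_distrib scaleR_right_distrib scaleR_right_diff_distrib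

section \<open>The full twist and the pieces of the unit\<close>

definition Z where "Z = S1 * (S2 * (S1 * (S1 * (S2 * S1))))"
definition g where "g = P - e1 - e2 - e3 + 2 *\<^sub>R e"
definition c1 where "c1 = e1 - e"
definition c2 where "c2 = e2 - e"
definition c3 where "c3 = e3 - e"

lemma Z_eq: "(S1 * S2) ^ 3 = Z"
  unfolding Z_def power3_eq_cube mult.assoc by (simp only: braid)

text \<open>By the braid relation the longest word \<open>S1 * (S2 * S1)\<close> exchanges
  \<open>S1\<close> and \<open>S2\<close> when moved past them; \<open>Z\<close> is its square and
  hence commutes with both.\<close>

lemma Z_S1: "Z * S1 = S1 * Z"
proof -
  have a: "S1 * (S2 * (S1 * (S1 * x))) = S2 * (S1 * (S2 * (S1 * x)))" for x by (simp only: braid_ext)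
  show ?thesis
    unfolding Z_def mult.assoc by (metis a braid braid_ext mult.assoc)
qed

lemma Z_S2: "Z * S2 = S2 * Z"
  unfolding Z_def by (metis braid braid_ext mult.assoc)

lemma rel_c: "c1 * S1 = S1 * c1" "c2 * S1 = S1 * c3" "c3 * S1 = S1 * c2"
   "c2 * S2 = S2 * c2" "c1 * S2 = S2 * c3" "c3 * S2 = S2 * c1"
   "e1 * c1 = c1" "e2 * c1 = 0" "e3 * c1 = 0" "P * c1 = c1" "t1 * c1 = c1"
   "e2 * c2 = c2" "e1 * c2 = 0" "e3 * c2 = 0" "P * c2 = c2" "t2 * c2 = c2"
   "e3 * c3 = c3" "e1 * c3 = 0" "e2 * c3 = 0" "P * c3 = c3" "t3 * c3 = c3"
   "e * c1 = 0" "e * c2 = 0" "e * c3 = 0" "e * g = 0" "e1 * g = 0" "e2 * g = 0" "e3 * g = 0" "P * g = g"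
  by (simp_all add: c1_def c2_def c3_def g_def nf scaleR_2)

lemmas nfc = nf rel_c rel_c[THEN mult_left_ext]

section \<open>Action of the full twist on each piece\<close>

lemma Z_g: "Z * g = q ^ 3 *\<^sub>R g"
  \<comment> \<open>All \<open>ei\<close> annihilate \<open>g\<close>, also after being moved past
    \<open>S1\<close> and \<open>S2\<close>. So each of the three squares met on reducing
    \<open>Z * g\<close> gives only \<open>q\<close> and a torus element, and the torus elements
    cancel.\<close>
  unfolding Z_def by (simp add: nfc power3_eq_cube)

text \<open>Two of the three squares meet \<open>e2\<close> or \<open>e3\<close>, which annihilate
  \<open>c1\<close>; only the last one meets \<open>e1\<close>, which fixes it.\<close>

lemma Z_c1: "Z * c1 = q\<^sup>2 *\<^sub>R (q *\<^sub>R c1 + (q - 1) *\<^sub>R (S1 * c1))"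
  unfolding Z_def by (simp add: nfc power2_eq_square mult.assoc)

text \<open>On the span of \<open>c1\<close> and \<open>S1 * c1\<close>, \<open>Z\<close> acts as a
  2 by 2 matrix with eigenvalues q^4 and q^2; this is its characteristic equation.\<close>

lemma Z_Z_c1: "Z * (Z * c1) = (q ^ 4 + q\<^sup>2) *\<^sub>R (Z * c1) - q ^ 6 *\<^sub>R c1"
proof -
  define a where "a = S1 * c1"
  have a: "Z * c1 = q ^ 3 *\<^sub>R c1 + (q ^ 3 - q\<^sup>2) *\<^sub>R a"
    by (simp add: Z_c1 a_def scaleR_right_distrib power2_eq_square power3_eq_cube algebra_simps)
  have "Z * a = S1 * (Z * c1)" unfolding a_def using Z_S1 by (simp flip: mult.assoc)
  also have "\<dots> = (q ^ 4 - q ^ 3) *\<^sub>R c1 + (q ^ 4 - q ^ 3 + q\<^sup>2) *\<^sub>R a"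
    by (simp add: Z_c1 nfc a_def eval_nat_numeral algebra_simps)
  finally have "Z * (Z * c1) = (q ^ 3 * q ^ 3 + (q ^ 3 - q\<^sup>2) * (q ^ 4 - q ^ 3)) *\<^sub>R c1
      + (q ^ 3 * (q ^ 3 - q\<^sup>2) + (q ^ 3 - q\<^sup>2) * (q ^ 4 - q ^ 3 + q\<^sup>2)) *\<^sub>R a"
    by (simp add: a distrib_left scaleR_right_distrib scaleR_left_distrib)
  also have "\<dots> = ((q ^ 4 + q\<^sup>2) * q ^ 3 - q ^ 6) *\<^sub>R c1 + ((q ^ 4 + q\<^sup>2) * (q ^ 3 - q\<^sup>2)) *\<^sub>R a"
    by (rule arg_cong2[of _ _ _ _ "\<lambda>x y. x *\<^sub>R c1 + y *\<^sub>R a"]; algebra)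
  also have "\<dots> = (q ^ 4 + q\<^sup>2) *\<^sub>R (Z * c1) - q ^ 6 *\<^sub>R c1"
    by (simp add: a scaleR_right_distrib scaleR_left_diff_distrib scaleR_right_diff_distrib right_diff_distrib)
  finally show ?thesis .
qed

text \<open>Coordinates on the span of the reduced words times \<open>e\<close>. The torus acts
  trivially there, so this is a copy of the regular module of the Iwahori-Hecke algebra of the
  symmetric group on three letters.\<close>

definition lin where "lin a0 a1 a2 a3 a4 a5 = a0 *\<^sub>R e + a1 *\<^sub>R (S1 * e) + a2 *\<^sub>R (S2 * e)
   + a3 *\<^sub>R (S1 * (S2 * e)) + a4 *\<^sub>R (S2 * (S1 * e)) + a5 *\<^sub>R (S1 * (S2 * (S1 * e)))"

lemma S1_lin: "S1 * lin a0 a1 a2 a3 a4 a5 =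
    lin (q * a1) (a0 + (q - 1) * a1) (q * a3) (a2 + (q - 1) * a3) (q * a5) (a4 + (q - 1) * a5)"
  by (simp add: lin_def nf algebra_simps)

lemma S2_lin: "S2 * lin a0 a1 a2 a3 a4 a5 =
    lin (q * a2) (q * a4) (a0 + (q - 1) * a2) (q * a5) (a1 + (q - 1) * a4) (a3 + (q - 1) * a5)"
  by (simp add: lin_def nf algebra_simps)

lemma lin_add: "lin a0 a1 a2 a3 a4 a5 + lin b0 b1 b2 b3 b4 b5 =
    lin (a0 + b0) (a1 + b1) (a2 + b2) (a3 + b3) (a4 + b4) (a5 + b5)"
  by (simp add: lin_def algebra_simps)

lemma lin_scale: "c *\<^sub>R lin a0 a1 a2 a3 a4 a5 = lin (c * a0) (c * a1) (c * a2) (c * a3) (c * a4) (c * a5)"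
  by (simp add: lin_def algebra_simps)

lemma e_lin: "e = lin 1 0 0 0 0 0" by (simp add: lin_def)

lemma tr_lin: "tr (lin a0 a1 a2 a3 a4 a5) = a0 * (N / (q - 1)\<^sup>2)"
  by (simp add: lin_def tr_add tr_scale tr_e tr_words)

text \<open>
  \<open>lin 1 1 1 1 1 1\<close> is the sum of all reduced words, which spans the trivial representation;
  \<open>(Z - q\<^sup>3) (Z - 1) e\<close> turns out to be \<open>K\<close> times it.
\<close>

definition K where "K = q^9 - 2*q^8 + 2*q^7 - 2*q^6 + 2*q^5 - 2*q^4 + q^3"

lemma Z_lin_all: "Z * lin 1 1 1 1 1 1 = q ^ 6 *\<^sub>R lin 1 1 1 1 1 1"
proof -
  have "S1 * lin 1 1 1 1 1 1 = q *\<^sub>R lin 1 1 1 1 1 1" "S2 * lin 1 1 1 1 1 1 = q *\<^sub>R lin 1 1 1 1 1 1"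
    by (simp_all add: S1_lin S2_lin lin_scale)
  then show ?thesis by (simp add: Z_def mult.assoc eval_nat_numeral)
qed

lemma Z_e: "Z * e = lin (q^3) (q^3-q^2) (q^3-q^2) (q^3-2*q^2+q) (q^3-2*q^2+q) (q^3-2*q^2+2*q-1)"
  by (subst e_lin) (simp add: Z_def mult.assoc S1_lin S2_lin eval_nat_numeral algebra_simps)

lemma Z_Z_e: "Z * (Z * e) = (q ^ 3 + 1) *\<^sub>R (Z * e) + (- (q ^ 3)) *\<^sub>R lin 1 0 0 0 0 0 + K *\<^sub>R lin 1 1 1 1 1 1"
  unfolding Z_e by (simp add: Z_def mult.assoc S1_lin S2_lin lin_add lin_scale K_def eval_nat_numeral algebra_simps)

section \<open>Traces of powers of the full twist\<close>

lemma Z_pow_S1: "Z ^ m * S1 = S1 * Z ^ m" and Z_pow_S2: "Z ^ m * S2 = S2 * Z ^ m"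
  by (simp_all add: power_commuting_commutes Z_S1 Z_S2)

text \<open>\<open>Z_Z_c1\<close> gives a two-term recursion with roots q^4 and q^2. Their
  multiplicities, in the ratio 1 to q, follow from the traces at powers 0 and 1; the factor
  \<open>q + 1\<close> clears the denominator.\<close>

lemma tr_Z_pow_c1: "(q + 1) * tr (Z ^ m * c1) = N * (q - 2) / (q - 1)\<^sup>2 * (q ^ (4 * m) + q ^ (2 * m + 1))"
proof -
  define T where "T = N * (q - 2) / (q - 1)\<^sup>2"
  have T: "tr c1 = T"
    using q by (simp add: c1_def tr_diff tr_ei tr_e T_def power2_eq_square divide_simps) (simp add: algebra_simps)
  have "tr (S1 * c1) = 0"
    by (simp add: c1_def right_diff_distrib tr_diff tr_e1_S1 tr_words)
  then have T1: "tr (Z * c1) = q ^ 3 * T"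
    by (simp add: Z_c1 tr_add tr_scale T power2_eq_square power3_eq_cube)
  have step: "tr (Z ^ Suc (Suc m) * c1) = (q ^ 4 + q\<^sup>2) * tr (Z ^ Suc m * c1) - q ^ 6 * tr (Z ^ m * c1)" for m
  proof -
    have "Z ^ Suc (Suc m) * c1 = Z ^ m * (Z * (Z * c1))"
      by (simp only: power_Suc2 mult.assoc)
    also have "\<dots> = (q ^ 4 + q\<^sup>2) *\<^sub>R (Z ^ Suc m * c1) - q ^ 6 *\<^sub>R (Z ^ m * c1)"
      by (simp only: Z_Z_c1 power_Suc2 mult.assoc right_diff_distrib mult_scaleR_right)
    finally show ?thesis by (simp only: tr_diff tr_scale)
  qed
  have "(q + 1) * tr (Z ^ m * c1) = T * (q ^ (4 * m) + q ^ (2 * m + 1)) \<and>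
    (q + 1) * tr (Z ^ Suc m * c1) = T * (q ^ (4 * Suc m) + q ^ (2 * Suc m + 1))"
  proof (induction m)
    case 0
    then show ?case by (simp add: T T1 eval_nat_numeral algebra_simps)
  next
    case (Suc m)
    have "(q + 1) * tr (Z ^ Suc (Suc m) * c1) =
       (q ^ 4 + q\<^sup>2) * ((q + 1) * tr (Z ^ Suc m * c1)) - q ^ 6 * ((q + 1) * tr (Z ^ m * c1))"
      unfolding step by (simp only: algebra_simps)
    also have "\<dots> = T * (q ^ (4 * Suc (Suc m)) + q ^ (2 * Suc (Suc m) + 1))"
      unfolding conjunct1[OF Suc.IH] conjunct2[OF Suc.IH]
      by (simp add: power_add power_mult eval_nat_numeral algebra_simps)
    finally show ?case using Suc.IH by simp
  qed
  then show ?thesis by (simp add: T_def)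
qed

text \<open>\<open>c1\<close>, \<open>c2\<close> and \<open>c3\<close> are conjugate under \<open>S1\<close> and \<open>S2\<close>, and \<open>Z\<close> is central.\<close>

lemma tr_Z_pow_c3: "tr (Z ^ m * c3) = tr (Z ^ m * c1)"
proof -
  \<comment> \<open>Since \<open>e2 * c3 = 0\<close>, \<open>S2 * S2\<close> acts on
    \<open>c3\<close> as \<open>q\<close> times \<open>t2\<close>, and \<open>t2\<close> squares to
    \<open>P\<close>. One \<open>S2\<close> is then carried around the trace, turning
    \<open>c3\<close> into \<open>c1\<close>.\<close>
  have "q * tr (Z ^ m * c3) = tr (Z ^ m * (S2 * (S2 * (t2 * c3))))"
    by (simp add: nfc tr_scale)
  also have "\<dots> = tr (S2 * (Z ^ m * (S2 * (t2 * c3))))"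
    by (metis Z_pow_S2 mult.assoc)
  also have "\<dots> = tr (Z ^ m * (S2 * (t2 * (c3 * S2))))"
    by (subst tr_cyc) (simp only: mult.assoc)
  also have "\<dots> = q * tr (Z ^ m * c1)"
    by (simp add: nfc tr_scale)
  finally show ?thesis using q by simp
qed

lemma tr_Z_pow_c2: "tr (Z ^ m * c2) = tr (Z ^ m * c1)"
proof -
  have "q * tr (Z ^ m * c2) = tr (Z ^ m * (S1 * (S1 * (t1 * c2))))"
    by (simp add: nfc tr_scale)
  also have "\<dots> = tr (S1 * (Z ^ m * (S1 * (t1 * c2))))"
    by (metis Z_pow_S1 mult.assoc)
  also have "\<dots> = tr (Z ^ m * (S1 * (t1 * (c2 * S1))))"
    by (subst tr_cyc) (simp only: mult.assoc)
  also have "\<dots> = q * tr (Z ^ m * c3)"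
    by (simp add: nfc tr_scale)
  finally show ?thesis using q tr_Z_pow_c3 by simp
qed

lemma tr_Z_pow_g: "tr (Z ^ m * g) = q ^ (3 * m) * (N - 3 * N / (q - 1) + 2 * N / (q - 1)\<^sup>2)"
proof -
  have "Z ^ m * g = q ^ (3 * m) *\<^sub>R g"
    by (induction m) (simp_all add: mult.assoc Z_g power_add mult.commute power_mult power3_eq_cube)
  then show ?thesis
    by (simp add: tr_scale g_def tr_add tr_diff tr_P tr_ei tr_e)
qed

text \<open>\<open>Z_Z_e\<close> gives a recursion with roots q^3 and 1 and an inhomogeneous term in
  q^6. The number \<open>T\<close> is both the number of complete flags in the projective plane and
  the sum of q^length over the six reduced words.\<close>

lemma tr_Z_pow_e:
  assumes N: "N = (q ^ 3 - 1) * (q\<^sup>2 - 1)"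
  shows "tr (Z ^ m * e) = q ^ (6 * m) + (2 * q\<^sup>2 + 2 * q) * q ^ (3 * m) + q ^ 3"
proof -
  define T where "T = (q\<^sup>2 + q + 1) * (q + 1)"
  have "N = T * (q - 1)\<^sup>2" unfolding N T_def by algebra
  then have T: "N / (q - 1)\<^sup>2 = T" using q by simp
  have S: "Z ^ m * lin 1 1 1 1 1 1 = q ^ (6 * m) *\<^sub>R lin 1 1 1 1 1 1" for m
    by (induction m) (simp_all add: mult.assoc Z_lin_all power_add)
  have step: "tr (Z ^ Suc (Suc m) * e) = (q ^ 3 + 1) * tr (Z ^ Suc m * e) - q ^ 3 * tr (Z ^ m * e) + K * T * q ^ (6 * m)" for m
  proof -
    have "Z ^ Suc (Suc m) * e = Z ^ m * (Z * (Z * e))"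
      by (simp only: power_Suc2 mult.assoc)
    also have "\<dots> = (q ^ 3 + 1) *\<^sub>R (Z ^ Suc m * e) + (- (q ^ 3)) *\<^sub>R (Z ^ m * e) + K *\<^sub>R (q ^ (6 * m) *\<^sub>R lin 1 1 1 1 1 1)"
      by (simp only: Z_Z_e power_Suc2 mult.assoc distrib_left mult_scaleR_right S flip: e_lin)
    finally show ?thesis by (simp add: tr_add tr_diff tr_scale tr_lin T)
  qed
  \<comment> \<open>\<open>T\<close> is the factor by which the sum of all reduced words differs
    from its idempotent, so \<open>K * T\<close> is the value of (Z - q^3)(Z - 1) at the eigenvalue
    q^6.\<close>
  have KT: "K * T = (q ^ 6 - q ^ 3) * (q ^ 6 - 1)"
    unfolding K_def T_def by algebra
  have "tr (Z ^ m * e) = q ^ (6 * m) + (2 * q\<^sup>2 + 2 * q) * q ^ (3 * m) + q ^ 3 \<and>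
     tr (Z ^ Suc m * e) = q ^ (6 * Suc m) + (2 * q\<^sup>2 + 2 * q) * q ^ (3 * Suc m) + q ^ 3"
  proof (induction m)
    case 0
    then show ?case by (simp add: tr_e T Z_e tr_lin) (simp add: T_def eval_nat_numeral algebra_simps)
  next
    case (Suc m)
    show ?case
      unfolding step conjunct1[OF Suc.IH] conjunct2[OF Suc.IH] KT
      by (simp add: power_add power_mult eval_nat_numeral algebra_simps)
  qed
  then show ?thesis ..
qed

theorem tr_power:
  assumes N: "N = (q ^ 3 - 1) * (q\<^sup>2 - 1)" and "m > 0"
  defines "f \<equiv> q ^ 3 - q\<^sup>2 - q - 2"
  shows "tr ((S1 * S2) ^ (3 * m)) = q ^ (6 * m) + 3 * f * q ^ (4 * m) +
    (q ^ 5 - 3 * q ^ 4 - 2 * q ^ 3 + 5 * q\<^sup>2 + 9 * q + 6) * q ^ (3 * m) + 3 * f * q ^ (2 * m + 1) + q ^ 3"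
proof -
  have "Z * P = Z" by (simp add: Z_def mult.assoc PS)
  \<comment> \<open>\<open>P\<close> need not be the unit of the ring, so at least one factor
    \<open>Z\<close> is needed to absorb it; this is where \<open>m > 0\<close> enters.\<close>
  then have ZP: "Z ^ m = Z ^ m * P"
    using \<open>m > 0\<close> by (metis Suc_pred' mult.assoc power_Suc2)
  have "P = g + c1 + c2 + c3 + e"
    by (simp add: g_def c1_def c2_def c3_def scaleR_2)
  from arg_cong[OF this, of "(*) (Z ^ m)"]
  have "Z ^ m = Z ^ m * g + Z ^ m * c1 + Z ^ m * c2 + Z ^ m * c3 + Z ^ m * e"
    by (simp only: distrib_left flip: ZP)
  from arg_cong[OF this, of tr]
  have "tr (Z ^ m) = tr (Z ^ m * g) + 3 * tr (Z ^ m * c1) + tr (Z ^ m * e)"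
    by (simp add: tr_add tr_Z_pow_c2 tr_Z_pow_c3)
  moreover have "tr (Z ^ m * c1) = f * (q ^ (4 * m) + q ^ (2 * m + 1))"
  proof -
    have "N * (q - 2) = (q + 1) * f * (q - 1)\<^sup>2" unfolding N f_def by algebra
    then have "N * (q - 2) / (q - 1)\<^sup>2 = (q + 1) * f" using q by simp
    with tr_Z_pow_c1[of m] q show ?thesis by simp
  qed
  moreover have "N - 3 * N / (q - 1) + 2 * N / (q - 1)\<^sup>2 = (q - 2) * (q - 3) * (q + 1) * (q\<^sup>2 + q + 1)"
  proof -
    have 1: "N / (q - 1) = (q ^ 3 - 1) * (q + 1)" "N / (q - 1)\<^sup>2 = (q\<^sup>2 + q + 1) * (q + 1)"
      using q by (simp_all add: N nonzero_divide_eq_eq) algebra+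
    show ?thesis using 1 N by algebra
  qed
  moreover have "tr ((S1 * S2) ^ (3 * m)) = tr (Z ^ m)" by (simp add: power_mult Z_eq)
  \<comment> \<open>The eigenvalue q^3 occurs both on the generic piece and on the piece of
    \<open>e\<close>; the two multiplicities add up.\<close>
  moreover have "(q - 2) * (q - 3) * (q + 1) * (q\<^sup>2 + q + 1) + (2 * q\<^sup>2 + 2 * q)
      = q ^ 5 - 3 * q ^ 4 - 2 * q ^ 3 + 5 * q\<^sup>2 + 9 * q + 6"
    by algebra
  \<comment> \<open>The powers with exponents in \<open>m\<close> are replaced by variables, so that
    a polynomial identity remains.\<close>
  moreover have "u * X + 3 * (f * (v + w)) + (s + Y * u + c) = s + 3 * f * v + Q * u + 3 * f * w + c"
    if "X + Y = Q" for u v w s c X Y Q :: real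
    unfolding that[symmetric] by algebra
  ultimately show ?thesis
    unfolding tr_Z_pow_g tr_Z_pow_e[OF N] by simp
qed

end

subsection \<open>Square matrices and closed walks\<close>

text \<open>A type of its own, so that \<open>*\<close> and \<open>^\<close> are the matrix product
  and its powers, as the locale expects.\<close>

typedef 'a sqmat = "UNIV :: ('a \<Rightarrow> 'a \<Rightarrow> real) set"
  morphisms entry Sqmat by simp

setup_lifting type_definition_sqmat

lemma sqmat_eqI: "(\<And>u v. entry A u v = entry B u v) \<Longrightarrow> A = B"
  by (metis entry_inject ext)

instantiation sqmat :: (finite) real_algebra_1
begin

lift_definition zero_sqmat :: "'a sqmat" is "\<lambda>u v. 0" .
lift_definition one_sqmat :: "'a sqmat" is "\<lambda>u v. of_bool (u = v)" .
lift_definition plus_sqmat :: "'a sqmat \<Rightarrow> 'a sqmat \<Rightarrow> 'a sqmat" is "\<lambda>A B u v. A u v + B u v" .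
lift_definition minus_sqmat :: "'a sqmat \<Rightarrow> 'a sqmat \<Rightarrow> 'a sqmat" is "\<lambda>A B u v. A u v - B u v" .
lift_definition uminus_sqmat :: "'a sqmat \<Rightarrow> 'a sqmat" is "\<lambda>A u v. - A u v" .
lift_definition scaleR_sqmat :: "real \<Rightarrow> 'a sqmat \<Rightarrow> 'a sqmat" is "\<lambda>c A u v. c * A u v" .
lift_definition times_sqmat :: "'a sqmat \<Rightarrow> 'a sqmat \<Rightarrow> 'a sqmat" is "\<lambda>A B u v. \<Sum>w\<in>UNIV. A u w * B w v" .

instance
proof
  fix A B C :: "'a sqmat" and a b :: real
  show "A * B * C = A * (B * C)"
  proof (transfer, intro ext)
    fix A B C :: "'a \<Rightarrow> 'a \<Rightarrow> real" and u v
    have "(\<Sum>w\<in>UNIV. (\<Sum>y\<in>UNIV. A u y * B y w) * C w v) = (\<Sum>w\<in>UNIV. \<Sum>y\<in>UNIV. A u y * (B y w * C w v))"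
      by (simp add: sum_distrib_right mult.assoc)
    also have "\<dots> = (\<Sum>y\<in>UNIV. \<Sum>w\<in>UNIV. A u y * (B y w * C w v))" by (rule sum.swap)
    finally show "(\<Sum>w\<in>UNIV. (\<Sum>y\<in>UNIV. A u y * B y w) * C w v) = (\<Sum>y\<in>UNIV. A u y * (\<Sum>w\<in>UNIV. B y w * C w v))"
      by (simp add: sum_distrib_left)
  qed
  show "0 \<noteq> (1 :: 'a sqmat)" by transfer (auto simp: fun_eq_iff)
qed (transfer; force simp: fun_eq_iff algebra_simps sum.distrib sum_distrib_left of_bool_def if_distrib[of "\<lambda>x. x * _"] if_distrib[of "\<lambda>x. _ * x"] cong: if_cong)+
end

section \<open>Traces, adjacency matrices and closed walks\<close>

definition mtrace :: "'a::finite sqmat \<Rightarrow> real" where "mtrace A = (\<Sum>u\<in>UNIV. entry A u u)"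

lemma mtrace_add: "mtrace (A + B) = mtrace A + mtrace B"
  by (simp add: mtrace_def plus_sqmat.rep_eq sum.distrib)

lemma mtrace_scaleR: "mtrace (c *\<^sub>R A) = c * mtrace A"
  by (simp add: mtrace_def scaleR_sqmat.rep_eq sum_distrib_left)

lemma mtrace_mult_commute: "mtrace (A * B) = mtrace (B * A)"
  unfolding mtrace_def times_sqmat.rep_eq by (subst sum.swap) (simp add: mult.commute)

lemma mtrace_sum: "mtrace (\<Sum>i\<in>I. f i) = (\<Sum>i\<in>I. mtrace (f i))"
  by (induction I rule: infinite_finite_induct) (simp_all add: mtrace_add, simp_all add: mtrace_def zero_sqmat.rep_eq)

lemma entry_sum: "entry (\<Sum>i\<in>I. f i) u v = (\<Sum>i\<in>I. entry (f i) u v)"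
  by (induction I rule: infinite_finite_induct) (simp_all add: zero_sqmat.rep_eq plus_sqmat.rep_eq)

definition rel_mat :: "('a \<Rightarrow> 'a \<Rightarrow> bool) \<Rightarrow> 'a sqmat" where
  "rel_mat R = Sqmat (\<lambda>u v. of_bool (R u v))"

lemma entry_rel_mat [simp]: "entry (rel_mat R) u v = of_bool (R u v)"
  by (simp add: rel_mat_def Sqmat_inverse)

lemma entry_rel_mat_mult: "entry (rel_mat R * rel_mat R') u v = card {w. R u w \<and> R' w v}" for u :: "'a::finite"
  by (simp add: times_sqmat.rep_eq flip: of_bool_conj)

text \<open>If the end points determine the middle vertex, every entry of the product counts at most
  one path, so the product is again a 0-1 matrix.\<close>

lemma rel_mat_mult_eq:
  fixes R :: "'a::finite \<Rightarrow> 'a \<Rightarrow> bool"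
  assumes "\<And>u v w. R u w \<and> R' w v \<longleftrightarrow> w = h u v \<and> R'' u v"
  shows "rel_mat R * rel_mat R' = rel_mat R''"
  by (rule sqmat_eqI) (simp add: entry_rel_mat_mult assms)

lemma mtrace_rel_mat: "mtrace (rel_mat R) = card {u :: 'a::finite. R u u}"
  by (simp add: mtrace_def)

definition walks :: "('a \<Rightarrow> 'a \<Rightarrow> bool) \<Rightarrow> nat \<Rightarrow> 'a list set" where
  "walks R n = {us. length us = Suc n \<and> (\<forall>i<n. R (us ! i) (us ! Suc i))}"

lemma finite_walks: "finite (walks R n :: 'a::finite list set)"
  by (rule finite_subset[OF _ finite_lists_length_eq[of UNIV "Suc n"]]) (auto simp: walks_def)

lemma entry_rel_mat_power:
  fixes R :: "'a::finite \<Rightarrow> 'a \<Rightarrow> bool"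
  shows "entry (rel_mat R ^ n) u v = card {us \<in> walks R n. us ! 0 = u \<and> us ! n = v}"
proof (induction n arbitrary: u)
  case 0
  have "{us \<in> walks R 0. us ! 0 = u \<and> us ! 0 = v} = (if u = v then {[u]} else {})"
    by (auto simp: walks_def length_Suc_conv)
  then show ?case by (simp add: one_sqmat.rep_eq)
next
  case (Suc n)
  let ?W = "\<lambda>w. {us \<in> walks R n. us ! 0 = w \<and> us ! n = v}"
  have "{us \<in> walks R (Suc n). us ! 0 = u \<and> us ! Suc n = v} = (#) u ` (\<Union>w\<in>{w. R u w}. ?W w)"
    (is "?L = ?R")
  proof
    show "?L \<subseteq> ?R"
    proof
      fix us assume "us \<in> ?L"
      then have us: "length us = Suc (Suc n)" "\<forall>i<Suc n. R (us ! i) (us ! Suc i)" "us ! 0 = u" "us ! Suc n = v"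
        by (auto simp: walks_def)
      then obtain ws where ws: "us = u # ws" by (cases us) auto
      with us have "ws \<in> ?W (ws ! 0)" "R u (ws ! 0)"
        by (auto simp: walks_def)
      then show "us \<in> ?R" using ws by blast
    qed
    show "?R \<subseteq> ?L"
      by (auto simp: walks_def nth_Cons split: nat.splits)
  qed
  then have "card {us \<in> walks R (Suc n). us ! 0 = u \<and> us ! Suc n = v} = card (\<Union>w\<in>{w. R u w}. ?W w)"
    by (simp add: card_image)
  also have "\<dots> = (\<Sum>w | R u w. card (?W w))"
    by (rule card_UN_disjoint) (auto intro: finite_subset[OF _ finite_walks])
  finally have "real (card {us \<in> walks R (Suc n). us ! 0 = u \<and> us ! Suc n = v}) = (\<Sum>w | R u w. real (card (?W w)))"
    by simp
  also have "\<dots> = entry (rel_mat R ^ Suc n) u v"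
    by (simp add: times_sqmat.rep_eq Suc.IH of_bool_def if_distrib[of "\<lambda>x. x * _"] sum.If_cases cong: if_cong)
  finally show ?case ..
qed

lemma mtrace_rel_mat_power:
  fixes R :: "'a::finite \<Rightarrow> 'a \<Rightarrow> bool"
  shows "mtrace (rel_mat R ^ n) = card {us \<in> walks R n. us ! n = us ! 0}"
proof -
  have "{us \<in> walks R n. us ! n = us ! 0} = (\<Union>u. {us \<in> walks R n. us ! 0 = u \<and> us ! n = u})"
    by auto
  then have "card {us \<in> walks R n. us ! n = us ! 0} = (\<Sum>u\<in>UNIV. card {us \<in> walks R n. us ! 0 = u \<and> us ! n = u})"
    by (simp only:) (rule card_UN_disjoint, auto intro: finite_subset[OF _ finite_walks])
  then show ?thesis by (simp add: mtrace_def entry_rel_mat_power)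
qed

subsection \<open>Flags over a finite field\<close>

definition dot :: "'k::field ^ 3 \<Rightarrow> 'k ^ 3 \<Rightarrow> 'k" where
  "dot x y = x $ 1 * y $ 1 + x $ 2 * y $ 2 + x $ 3 * y $ 3"

definition cross :: "'k::field ^ 3 \<Rightarrow> 'k ^ 3 \<Rightarrow> 'k ^ 3" where
  "cross x y = vector [x $ 2 * y $ 3 - x $ 3 * y $ 2, x $ 3 * y $ 1 - x $ 1 * y $ 3,
     x $ 1 * y $ 2 - x $ 2 * y $ 1]"

lemma cross_nth [simp]:
  "cross x y $ 1 = x $ 2 * y $ 3 - x $ 3 * y $ 2"
  "cross x y $ 2 = x $ 3 * y $ 1 - x $ 1 * y $ 3"
  "cross x y $ 3 = x $ 1 * y $ 2 - x $ 2 * y $ 1"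
  by (simp_all add: cross_def)

lemma vec3_eq_iff: "x = y \<longleftrightarrow> x $ 1 = y $ 1 \<and> x $ 2 = y $ 2 \<and> x $ 3 = y $ 3" for x y :: "'a ^ 3"
  by (simp add: vec_eq_iff forall_3)

lemma dot_commute: "dot x y = dot y x"
  by (simp add: dot_def mult.commute)

lemma dot_scale: "dot (c *s x) y = c * dot x y" "dot x (c *s y) = c * dot x y"
  by (simp_all add: dot_def algebra_simps)

lemma dot_add: "dot x (y + z) = dot x y + dot x z"
  by (simp add: dot_def algebra_simps)

lemma dot_diff: "dot x (y - z) = dot x y - dot x z"
  by (simp add: dot_def algebra_simps)

lemma dot_zero [simp]: "dot 0 x = 0" "dot x 0 = 0"
  by (simp_all add: dot_def)

lemma cross_scale: "cross (c *s x) y = c *s cross x y" "cross x (c *s y) = c *s cross x y"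
  by (simp_all add: vec3_eq_iff algebra_simps)

lemma cross_add: "cross (x + y) z = cross x z + cross y z" "cross x (y + z) = cross x y + cross x z"
  by (simp_all add: vec3_eq_iff algebra_simps)

lemma cross_self [simp]: "cross x x = 0"
  by (simp add: vec3_eq_iff)

lemma cross_zero [simp]: "cross 0 x = 0" "cross x 0 = 0"
  by (simp_all add: vec3_eq_iff)

lemma cross_skew: "cross x y = - cross y x"
  by (simp add: vec3_eq_iff)

lemma dot_cross_self [simp]: "dot x (cross x y) = 0" "dot y (cross x y) = 0" "dot (cross x y) x = 0" "dot (cross x y) y = 0"
  by (simp_all add: dot_def algebra_simps)

lemma cross_cross_right: "cross x (cross y z) = dot x z *s y - dot x y *s z"
  by (simp add: vec3_eq_iff dot_def algebra_simps)

lemma cross_cross_left: "cross (cross x y) z = dot x z *s y - dot y z *s x"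
  by (simp add: vec3_eq_iff dot_def algebra_simps)

lemma exists_dot_1:
  assumes "x \<noteq> 0"
  obtains y where "dot x y = 1"
proof -
  from assms consider "x $ 1 \<noteq> 0" | "x $ 2 \<noteq> 0" | "x $ 3 \<noteq> 0" by (auto simp: vec3_eq_iff)
  then show ?thesis
  proof cases
    case 1 then show ?thesis using that[of "vector [1 / x $ 1, 0, 0]"] by (simp add: dot_def)
  next
    case 2 then show ?thesis using that[of "vector [0, 1 / x $ 2, 0]"] by (simp add: dot_def)
  next
    case 3 then show ?thesis using that[of "vector [0, 0, 1 / x $ 3]"] by (simp add: dot_def)
  qed
qed

text \<open>Expanding \<open>cross (cross x y) z\<close> with \<open>dot x z = 1\<close> isolates
  \<open>y\<close>.\<close>

lemma cross_eq_0_imp_parallel: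
  assumes "cross x y = 0" "x \<noteq> 0"
  obtains c where "y = c *s x"
proof -
  obtain z where "dot x z = 1" using exists_dot_1 assms(2) by blast
  moreover have "cross (cross x y) z = 0" by (simp add: assms)
  ultimately show ?thesis using that[of "dot y z"] by (simp add: cross_cross_left)
qed

text \<open>The witness is \<open>cross x z\<close> with \<open>dot f z = 1\<close>, by the double
  cross product expansion.\<close>

lemma exists_cross_eq:
  assumes "f \<noteq> 0" "dot x f = 0"
  obtains y where "cross f y = x"
proof -
  obtain z where "dot f z = 1" using exists_dot_1 assms(1) by blast
  then have "cross f (cross x z) = x" using assms(2) by (simp add: cross_cross_right dot_commute)
  then show ?thesis using that by blast
qed

text \<open>The q level sets of \<open>dot x\<close> are translates of one another along
  \<open>z\<close> and partition the space of q^3 vectors.\<close>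

lemma card_dot_eq_0:
  fixes x :: "'k::{field,finite} ^ 3"
  assumes "x \<noteq> 0"
  shows "card {y. dot x y = 0} = CARD('k) ^ 2"
proof -
  obtain z where z: "dot x z = 1" using exists_dot_1 assms by blast
  have *: "card {y. dot x y = c} = card {y. dot x y = 0}" for c
    by (rule bij_betw_same_card[of "\<lambda>y. y - c *s z"], rule bij_betw_byWitness[of _ "\<lambda>y. y + c *s z"])
      (auto simp: z dot_scale dot_add dot_diff)
  have "CARD('k ^ 3) = (\<Sum>c\<in>UNIV. card {y. dot x y = c})"
  proof -
    have "card (\<Union>c. {y. dot x y = c}) = (\<Sum>c\<in>UNIV. card {y. dot x y = c})"
      by (rule card_UN_disjoint) auto
    moreover have "(\<Union>c. {y. dot x y = c}) = UNIV" by auto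
    ultimately show ?thesis by (simp only:)
  qed
  moreover have "(\<Sum>c\<in>UNIV. card {y. dot x y = c}) = CARD('k) * card {y. dot x y = 0}"
    by (subst sum.cong[OF refl *]) simp
  ultimately have "CARD('k) * CARD('k) ^ 2 = CARD('k) * card {y. dot x y = 0}"
    by (simp add: eval_nat_numeral)
  then show ?thesis by simp
qed

section \<open>Half steps and the torus action\<close>

type_synonym 'k vec_pair = "('k ^ 3) \<times> ('k ^ 3)"

text \<open>
  In \<open>step1\<close> and \<open>step2\<close> the cross product equations force both pairs to consist of nonzero orthogonal
  vectors, so the matrices below vanish off the set of flags.
\<close>

fun step1 :: "'k::field vec_pair \<Rightarrow> 'k vec_pair \<Rightarrow> bool" where
  "step1 (x, f) (x', f') \<longleftrightarrow> x \<noteq> 0 \<and> x' = x \<and> cross f f' = x"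

fun step2 :: "'k::field vec_pair \<Rightarrow> 'k vec_pair \<Rightarrow> bool" where
  "step2 (x, f) (x', f') \<longleftrightarrow> f \<noteq> 0 \<and> f' = f \<and> cross x x' = f"

text \<open>The restriction to flags makes \<open>H 1 1\<close> the projection onto them, which
  plays the role of \<open>P\<close>.\<close>

fun torus_step :: "'k::field \<Rightarrow> 'k \<Rightarrow> 'k vec_pair \<Rightarrow> 'k vec_pair \<Rightarrow> bool" where
  "torus_step a b (x, f) (x', f') \<longleftrightarrow> x \<noteq> 0 \<and> f \<noteq> 0 \<and> dot x f = 0 \<and> x' = a *s x \<and> f' = b *s f"

abbreviation S1 :: "'k::{field,finite} vec_pair sqmat" where "S1 \<equiv> rel_mat step1"
abbreviation S2 :: "'k::{field,finite} vec_pair sqmat" where "S2 \<equiv> rel_mat step2"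
abbreviation H :: "'k::{field,finite} \<Rightarrow> 'k \<Rightarrow> 'k vec_pair sqmat"
  where "H a b \<equiv> rel_mat (torus_step a b)"

lemma H_mult_H:
  assumes "a \<noteq> 0" "b \<noteq> 0"
  shows "H a b * H c d = H (a * c) (b * d)"
proof (rule rel_mat_mult_eq[where h = "\<lambda>u v. (a *s fst u, b *s snd u)"])
  fix u v w :: "'a vec_pair"
  obtain x f y g x' f' where [simp]: "u = (x, f)" "w = (y, g)" "v = (x', f')"
    by (metis surj_pair)
  have "c *s (a *s x) = (a * c) *s x" "d *s (b *s f) = (b * d) *s f"
    by (simp_all add: vec3_eq_iff)
  then show "torus_step a b u w \<and> torus_step c d w v \<longleftrightarrow>
      w = (a *s fst u, b *s snd u) \<and> torus_step (a * c) (b * d) u v"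
    using assms by (auto simp: dot_scale)
qed

lemma H_mult_S1:
  assumes "a \<noteq> 0" "b \<noteq> 0"
  shows "H a b * S1 = rel_mat (\<lambda>(x, f) (x', f'). x \<noteq> 0 \<and> x' = a *s x \<and> x = (b / a) *s cross f f')"
proof (rule rel_mat_mult_eq[where h = "\<lambda>u v. (a *s fst u, b *s snd u)"])
  fix u v w :: "'a vec_pair"
  obtain x f y g x' f' where [simp]: "u = (x, f)" "w = (y, g)" "v = (x', f')"
    by (metis surj_pair)
  have "b *s cross f f' = a *s x \<longleftrightarrow> x = (b / a) *s cross f f'"
    using assms by (auto simp: vec3_eq_iff field_simps)
  then show "torus_step a b u w \<and> step1 w v \<longleftrightarrow> w = (a *s fst u, b *s snd u) \<and>
      (\<lambda>(x, f) (x', f'). x \<noteq> 0 \<and> x' = a *s x \<and> x = (b / a) *s cross f f') u v"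
    using assms by (auto simp: cross_scale dot_scale)
qed

lemma S1_mult_H:
  assumes "a \<noteq> 0" "b \<noteq> 0"
  shows "S1 * H a b = rel_mat (\<lambda>(x, f) (x', f'). x \<noteq> 0 \<and> x' = a *s x \<and> x = (1 / b) *s cross f f')"
proof (rule rel_mat_mult_eq[where h = "\<lambda>u v. (fst u, (1 / b) *s snd v)"])
  fix u v w :: "'a vec_pair"
  obtain x f y g x' f' where [simp]: "u = (x, f)" "w = (y, g)" "v = (x', f')"
    by (metis surj_pair)
  have "f' = b *s g \<longleftrightarrow> g = (1 / b) *s f'"
    using assms by (auto simp: vec3_eq_iff field_simps)
  then show "step1 u w \<and> torus_step a b w v \<longleftrightarrow> w = (fst u, (1 / b) *s snd v) \<and>
      (\<lambda>(x, f) (x', f'). x \<noteq> 0 \<and> x' = a *s x \<and> x = (1 / b) *s cross f f') u v"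
    using assms by (auto simp: cross_scale dot_scale)
qed

text \<open>Scaling \<open>x\<close> by \<open>a\<close> and \<open>f\<close> by \<open>b\<close> in
  \<open>cross f f' = x\<close> forces \<open>f'\<close> to be scaled by \<open>a / b\<close>: this
  is the simple reflection acting on the torus.\<close>

lemma H_S1:
  assumes "a \<noteq> 0" "b \<noteq> 0"
  shows "H a b * S1 = S1 * H a (a / b)"
  using assms by (simp add: H_mult_S1 S1_mult_H)

lemma S2_mult_S1: "S2 * S1 = rel_mat (\<lambda>(x, f) (x', f'). f \<noteq> 0 \<and> x' \<noteq> 0 \<and> cross x x' = f \<and> cross f f' = x')"
  by (rule rel_mat_mult_eq[where h = "\<lambda>u v. (fst v, snd u)"]) auto

lemma S1_mult_S2: "S1 * S2 = rel_mat (\<lambda>(x, f) (x', f'). x \<noteq> 0 \<and> f' \<noteq> 0 \<and> cross f f' = x \<and> cross x x' = f')"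
  by (rule rel_mat_mult_eq[where h = "\<lambda>u v. (fst u, snd v)"]) auto

lemma smult_eq_self_iff: "c *s x = x \<longleftrightarrow> c = 1 \<or> x = 0" "x = c *s x \<longleftrightarrow> c = 1 \<or> x = 0" for x :: "'k::field ^ 3"
  by (auto simp: vec3_eq_iff)

text \<open>The double cross products expand to multiples of \<open>x\<close> and \<open>x'\<close>.
  The right side says that the two flags are in general position, with both pairings normalised to
  1.\<close>

lemma opposite_iff:
  "x \<noteq> 0 \<and> cross x x' \<noteq> 0 \<and> x' \<noteq> 0 \<and> cross f (cross x x') = x \<and> cross (cross x x') f' = x'
    \<longleftrightarrow> dot x f = 0 \<and> dot x' f' = 0 \<and> dot x f' = 1 \<and> dot x' f = 1" (is "?L \<longleftrightarrow> ?R")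
proof
  assume L: ?L
  then have "dot x f = 0" "dot x' f' = 0"
    by (metis dot_cross_self(3)) (metis L dot_cross_self(4))
  moreover from L this have "dot x' f *s x = x" "dot x f' *s x' = x'"
    by (simp_all add: cross_cross_left cross_cross_right dot_commute[of f])
  ultimately show ?R using L smult_eq_self_iff by blast
next
  assume R: ?R
  then have "cross f (cross x x') = x" "cross (cross x x') f' = x'"
    by (simp_all add: cross_cross_left cross_cross_right dot_commute[of f])
  moreover have "x \<noteq> 0" "x' \<noteq> 0" using R by auto
  ultimately show ?L by (metis cross_zero(2))
qed

text \<open>The middle form is \<open>cross x x'\<close>. The resulting condition is symmetric in
  vectors and forms, which is what yields the braid relation.\<close>

lemma S1_S2_S1: "S1 * (S2 * S1) = rel_mat (\<lambda>(x, f) (x', f'). dot x f = 0 \<and> dot x' f' = 0 \<and> dot x f' = 1 \<and> dot x' f = 1)"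
  unfolding S2_mult_S1
proof (rule rel_mat_mult_eq[where h = "\<lambda>u v. (fst u, cross (fst u) (fst v))"])
  fix u v w :: "'a vec_pair"
  obtain x f y g x' f' where [simp]: "u = (x, f)" "w = (y, g)" "v = (x', f')"
    by (metis surj_pair)
  show "step1 u w \<and> (\<lambda>(x, f) (x', f'). f \<noteq> 0 \<and> x' \<noteq> 0 \<and> cross x x' = f \<and> cross f f' = x') w v \<longleftrightarrow>
      w = (fst u, cross (fst u) (fst v)) \<and>
      (\<lambda>(x, f) (x', f'). dot x f = 0 \<and> dot x' f' = 0 \<and> dot x f' = 1 \<and> dot x' f = 1) u v"
    using opposite_iff[of x x' f f'] by (simp only: prod.case step1.simps fst_conv snd_conv prod.inject \<open>u = _\<close> \<open>v = _\<close> \<open>w = _\<close>) metis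
qed

text \<open>Exchanging \<open>x\<close> and \<open>f\<close> exchanges \<open>S1\<close> and \<open>S2\<close>, which halves the number of relations to check.\<close>

definition dual :: "'k::{field,finite} vec_pair sqmat \<Rightarrow> 'k vec_pair sqmat" where
  "dual A = Sqmat (\<lambda>u v. entry A (prod.swap u) (prod.swap v))"

lemma entry_dual: "entry (dual A) u v = entry A (prod.swap u) (prod.swap v)"
  by (simp add: dual_def Sqmat_inverse)

lemma dual_mult: "dual (A * B) = dual A * dual B"
proof (rule sqmat_eqI)
  fix u v :: "'a vec_pair"
  have "(\<Sum>w\<in>UNIV. entry A (prod.swap u) w * entry B w (prod.swap v)) =
      (\<Sum>w\<in>UNIV. entry A (prod.swap u) (prod.swap w) * entry B (prod.swap w) (prod.swap v))"
    by (rule sum.reindex_bij_witness[of _ prod.swap prod.swap]) auto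
  then show "entry (dual (A * B)) u v = entry (dual A * dual B) u v"
    by (simp add: entry_dual times_sqmat.rep_eq)
qed

lemma dual_add: "dual (A + B) = dual A + dual B"
  by (rule sqmat_eqI) (simp add: entry_dual plus_sqmat.rep_eq)

lemma dual_scaleR: "dual (c *\<^sub>R A) = c *\<^sub>R dual A"
  by (rule sqmat_eqI) (simp add: entry_dual scaleR_sqmat.rep_eq)

lemma dual_sum: "dual (\<Sum>i\<in>I. f i) = (\<Sum>i\<in>I. dual (f i))"
  by (rule sqmat_eqI) (simp add: entry_dual entry_sum)

lemma dual_S: "dual S1 = S2" "dual S2 = S1"
  by (rule sqmat_eqI, auto simp: entry_dual)+

lemma dual_H: "dual (H a b) = H b a"
  by (rule sqmat_eqI) (auto simp: entry_dual dot_commute)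

lemma braid: "S2 * (S1 * S2) = S1 * (S2 * S1)"
proof -
  have "S2 * (S1 * S2) = dual (S1 * (S2 * S1))" by (simp add: dual_mult dual_S)
  also have "\<dots> = S1 * (S2 * S1)"
    unfolding S1_S2_S1 by (rule sqmat_eqI) (auto simp: entry_dual dot_commute)
  finally show ?thesis .
qed

section \<open>Traces of torus elements\<close>

lemma mtrace_H:
  assumes "a \<noteq> 1 \<or> b \<noteq> 1"
  shows "mtrace (H a b) = 0"
proof -
  have "{u. torus_step a b u u} = {}" using assms by (auto simp: smult_eq_self_iff)
  then show ?thesis by (simp add: mtrace_rel_mat)
qed

lemma CARD_field_ge_2: "CARD('k::{field,finite}) \<ge> 2"
  using card_mono[of UNIV "{0, 1 :: 'k}"] by simp

text \<open>Choose a nonzero \<open>x\<close>, then a nonzero \<open>f\<close> among the q^2 vectors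
  orthogonal to it.\<close>

lemma mtrace_H11: "mtrace (H 1 1 :: 'k::{field,finite} vec_pair sqmat) = (real CARD('k) ^ 3 - 1) * (real CARD('k) ^ 2 - 1)"
proof -
  have "{u :: 'k vec_pair. torus_step 1 1 u u} = (SIGMA x:UNIV - {0}. {f. dot x f = 0} - {0})"
    by auto
  moreover have "card (SIGMA x:UNIV - {0 :: 'k ^ 3}. {f. dot x f = 0} - {0}) = (\<Sum>x\<in>UNIV - {0 :: 'k ^ 3}. CARD('k) ^ 2 - 1)"
    by (subst card_SigmaI) (auto intro!: sum.cong simp: card_dot_eq_0 card_Diff_singleton)
  moreover have "card (UNIV - {0 :: 'k ^ 3}) = CARD('k) ^ 3 - 1"
    by (simp add: card_Diff_singleton)
  ultimately show ?thesis
    using one_le_power[of "CARD('k)" 2] one_le_power[of "CARD('k)" 3] CARD_field_ge_2[where 'k = 'k]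
    by (simp add: mtrace_rel_mat of_nat_diff del: One_nat_def)
qed

text \<open>A diagonal entry would need \<open>R\<close> to relate a pair to a rescaling of
  itself.\<close>

lemma mtrace_rel_mat_mult_H:
  assumes "\<And>x f a b. a \<noteq> 0 \<Longrightarrow> b \<noteq> 0 \<Longrightarrow> \<not> R (x, f) (a *s x, b *s f)" "a \<noteq> 0" "b \<noteq> 0"
  shows "mtrace (rel_mat R * H a b) = 0"
proof -
  have "{w. R u w \<and> torus_step a b w u} = {}" for u
  proof -
    obtain x f where u: "u = (x, f)" by (cases u)
    have "\<not> R (x, f) (y, g)" if "x = a *s y" "f = b *s g" for y g
      using assms(1)[of "1 / a" "1 / b" x f] assms(2,3) that by (simp add: vector_smult_assoc)
    then show ?thesis by (auto simp: u)
  qed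
  then show ?thesis
    unfolding mtrace_def entry_rel_mat_mult by (simp only: card.empty) simp
qed

section \<open>Averaging idempotents\<close>

definition avg :: "('k::{field,finite} \<Rightarrow> 'r::real_algebra_1) \<Rightarrow> 'r" where
  "avg F = (1 / (real CARD('k) - 1)) *\<^sub>R (\<Sum>c\<in>UNIV - {0}. F c)"

lemma card_units: "real (card (UNIV - {0 :: 'k::{field,finite}})) = real CARD('k) - 1"
  using CARD_field_ge_2[where 'k = 'k] by (simp add: card_Diff_singleton of_nat_diff)

lemma avg_cong: "(\<And>c. c \<noteq> 0 \<Longrightarrow> F c = G c) \<Longrightarrow> avg F = avg G"
  by (simp add: avg_def)

lemma avg_const [simp]: "avg (\<lambda>c :: 'k::{field,finite}. A) = A"
proof -
  have "real CARD('k) - 1 \<noteq> 0" using CARD_field_ge_2[where 'k = 'k] by linarith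
  then show ?thesis
    unfolding avg_def sum_constant_scaleR card_units by simp
qed

lemma avg_mult: "avg F * A = avg (\<lambda>c. F c * A)" "A * avg F = avg (\<lambda>c. A * F c)"
  by (simp_all add: avg_def sum_distrib_left sum_distrib_right)

lemma avg_reindex:
  assumes "\<And>c. c \<noteq> 0 \<Longrightarrow> h c \<noteq> 0 \<and> h' c \<noteq> 0 \<and> h (h' c) = c \<and> h' (h c) = c"
  shows "avg (\<lambda>c. F (h c)) = avg F"
  unfolding avg_def by (intro arg_cong[of _ _ "(*\<^sub>R) _"] sum.reindex_bij_witness[of _ h' h]) (use assms in auto)

lemma avg_scale: "a \<noteq> 0 \<Longrightarrow> avg (\<lambda>c. F (a * c)) = avg F" "a \<noteq> 0 \<Longrightarrow> avg (\<lambda>c. F (c * a)) = avg F"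
  by (rule avg_reindex[where h' = "\<lambda>c. c / a"]; simp)+

lemma avg_inverse: "a \<noteq> 0 \<Longrightarrow> avg (\<lambda>c. F (a / c)) = avg F"
  by (rule avg_reindex[where h' = "\<lambda>c. a / c"]; simp)

lemma avg_swap: "avg (\<lambda>a. avg (\<lambda>b. F a b)) = avg (\<lambda>b. avg (\<lambda>a. F a b))"
  unfolding avg_def scaleR_sum_right[symmetric] by (subst sum.swap) simp

lemma mtrace_avg: "mtrace (avg F) = (\<Sum>c\<in>UNIV - {0}. mtrace (F c)) / (real CARD('k) - 1)"
  for F :: "'k::{field,finite} \<Rightarrow> 'a::finite sqmat"
  by (simp add: avg_def mtrace_scaleR mtrace_sum)

lemma dual_avg: "dual (avg F) = avg (\<lambda>c. dual (F c))"
  by (simp add: avg_def dual_scaleR dual_sum)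

text \<open>The coroot subgroups for \<open>S1\<close> and \<open>S2\<close> scale only
  \<open>f\<close> and only \<open>x\<close>; conjugating the second by \<open>S1\<close> gives the
  diagonal one behind \<open>E3\<close>.\<close>

definition E1 :: "'k::{field,finite} vec_pair sqmat" where "E1 = avg (\<lambda>b. H 1 b)"
definition E2 :: "'k::{field,finite} vec_pair sqmat" where "E2 = avg (\<lambda>a. H a 1)"
definition E3 :: "'k::{field,finite} vec_pair sqmat" where "E3 = avg (\<lambda>c. H c c)"
definition E :: "'k::{field,finite} vec_pair sqmat" where "E = avg (\<lambda>a. avg (\<lambda>b. H a b))"
lemmas E_defs = E1_def E2_def E3_def E_def

lemma E_swap: "E = avg (\<lambda>b. avg (\<lambda>a. H a b))"
  unfolding E_def by (rule avg_swap)

lemma dual_E: "dual E1 = E2" "dual E2 = E1" "dual E3 = E3" "dual E = E"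
  by (simp_all add: E1_def E2_def E3_def dual_avg dual_H) (subst E_swap, simp add: E_def dual_avg dual_H)

lemma E_S1: "E1 * S1 = S1 * E1" "E2 * S1 = S1 * E3" "E3 * S1 = S1 * E2" "E * S1 = S1 * E"
proof -
  show "E1 * S1 = S1 * E1"
    using avg_inverse[of 1 "\<lambda>b. S1 * H 1 b"] by (simp add: E1_def avg_mult H_S1 cong: avg_cong)
  show "E2 * S1 = S1 * E3" "E3 * S1 = S1 * E2"
    by (simp_all add: E2_def E3_def avg_mult H_S1 cong: avg_cong)
  show "E * S1 = S1 * E"
    by (simp add: E_def avg_mult H_S1 avg_inverse[of _ "\<lambda>b. S1 * H _ b"] cong: avg_cong)
qed

lemma H_S2:
  assumes "a \<noteq> 0" "b \<noteq> 0"
  shows "H a b * S2 = S2 * H (b / a) b"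
  using arg_cong[OF H_S1[OF assms(2,1)], of dual] by (simp add: dual_mult dual_H dual_S)

lemma E_S2: "E2 * S2 = S2 * E2" "E1 * S2 = S2 * E3" "E3 * S2 = S2 * E1" "E * S2 = S2 * E"
  using E_S1[THEN arg_cong[of _ _ dual]] by (simp_all add: dual_mult dual_E dual_S)

lemma H_E_absorb: "c \<noteq> 0 \<Longrightarrow> H 1 c * E1 = E1" "c \<noteq> 0 \<Longrightarrow> H c 1 * E2 = E2" "c \<noteq> 0 \<Longrightarrow> H c c * E3 = E3"
  by (simp_all add: E1_def E2_def E3_def avg_mult H_mult_H avg_scale(1)[of _ "H 1"]
     avg_scale[of _ "\<lambda>c. H c c"] avg_scale[of _ "\<lambda>c. H c 1"] cong: avg_cong)

lemma H_E_absorb': "a \<noteq> 0 \<Longrightarrow> b \<noteq> 0 \<Longrightarrow> H a b * E = E"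
  using avg_scale(1)[of a "\<lambda>c. avg (H c)"]
  by (simp add: E_def avg_mult H_mult_H avg_scale(1)[of b "H _"] cong: avg_cong)

lemma H_E_commute:
  assumes "a \<noteq> 0" "b \<noteq> 0"
  shows "E1 * H a b = H a b * E1" "E2 * H a b = H a b * E2" "E3 * H a b = H a b * E3" "E * H a b = H a b * E"
  using assms by (simp_all add: E1_def E2_def E3_def E_def avg_mult H_mult_H mult.commute cong: avg_cong)

lemma E_idem: "E1 * E1 = E1" "E2 * E2 = E2" "E3 * E3 = E3" "E * E = E" "E1 * E = E" "E2 * E = E" "E3 * E = E"
  by (subst (1) E1_def E2_def E3_def E_def, simp add: avg_mult H_E_absorb H_E_absorb' cong: avg_cong)+

lemma commute_E:
  assumes "\<And>a b. a \<noteq> 0 \<Longrightarrow> b \<noteq> 0 \<Longrightarrow> A * H a b = H a b * A"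
  shows "A * E1 = E1 * A" "A * E2 = E2 * A" "A * E3 = E3 * A"
  using assms by (simp_all add: E1_def E2_def E3_def avg_mult cong: avg_cong)

text \<open>The torus is the direct product of any two of the three coroot subgroups.\<close>

lemma E_mult: "E1 * E2 = E" "E2 * E1 = E" "E1 * E3 = E" "E3 * E1 = E" "E2 * E3 = E" "E3 * E2 = E"
    "E * E1 = E" "E * E2 = E" "E * E3 = E"
proof -
  show 21: "E2 * E1 = E"
  proof -
    have "E2 * E1 = avg (\<lambda>a. H a 1 * E1)" by (simp only: E2_def avg_mult(1))
    also have "\<dots> = E" by (simp add: E1_def E_def avg_mult(2) H_mult_H cong: avg_cong)
    finally show ?thesis .
  qed
  then show 12: "E1 * E2 = E"
    by (metis dual_E(1,2,4) dual_mult)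
  show 31: "E3 * E1 = E"
  proof -
    have "E3 * E1 = avg (\<lambda>c. H c c * E1)" by (simp only: E3_def avg_mult(1))
    also have "\<dots> = E" by (simp add: E1_def E_def avg_mult(2) H_mult_H avg_scale(1)[of _ "H _"] cong: avg_cong)
    finally show ?thesis .
  qed
  then show 32: "E3 * E2 = E"
    by (metis dual_E dual_mult)
  show "E1 * E3 = E" "E2 * E3 = E" "E * E3 = E" "E * E1 = E" "E * E2 = E"
    using 31 32 E_idem(5-7) commute_E(3)[OF H_E_commute(1)] commute_E(3)[OF H_E_commute(2)]
      commute_E[OF H_E_commute(4)] by metis+
qed

text \<open>Among the averaged torus elements only the identity has nonzero trace, so the trace is
  divided by the order of the subgroup.\<close>

lemma mtrace_E: "mtrace (E1 :: 'k::{field,finite} vec_pair sqmat) = mtrace (H 1 1 :: 'k vec_pair sqmat) / (real CARD('k) - 1)"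
   "mtrace (E2 :: 'k::{field,finite} vec_pair sqmat) = mtrace (H 1 1 :: 'k vec_pair sqmat) / (real CARD('k) - 1)"
   "mtrace (E3 :: 'k::{field,finite} vec_pair sqmat) = mtrace (H 1 1 :: 'k vec_pair sqmat) / (real CARD('k) - 1)"
   "mtrace (E :: 'k::{field,finite} vec_pair sqmat) = mtrace (H 1 1 :: 'k vec_pair sqmat) / (real CARD('k) - 1)\<^sup>2"
proof -
  have *: "(\<Sum>c\<in>UNIV - {0}. F c) = F 1" if "\<And>c. c \<noteq> 1 \<Longrightarrow> F c = 0" for F :: "'k \<Rightarrow> real"
    by (rule sum.remove[where x = 1, THEN trans]) (auto simp: that)
  note [simp] = *[of "\<lambda>c. mtrace (H 1 c)"] *[of "\<lambda>c. mtrace (H c 1)"] *[of "\<lambda>c. mtrace (H c c)"]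
  have avg_H: "mtrace (avg (H a)) = (if a = 1 then mtrace (H 1 1 :: 'k vec_pair sqmat) / (real CARD('k) - 1) else 0)" for a :: 'k
    by (simp add: mtrace_avg mtrace_H)
  show "mtrace (E1 :: 'k vec_pair sqmat) = mtrace (H 1 1 :: 'k vec_pair sqmat) / (real CARD('k) - 1)"
   "mtrace (E2 :: 'k vec_pair sqmat) = mtrace (H 1 1 :: 'k vec_pair sqmat) / (real CARD('k) - 1)"
   "mtrace (E3 :: 'k vec_pair sqmat) = mtrace (H 1 1 :: 'k vec_pair sqmat) / (real CARD('k) - 1)"
   "mtrace (E :: 'k vec_pair sqmat) = mtrace (H 1 1 :: 'k vec_pair sqmat) / (real CARD('k) - 1)\<^sup>2"
    by (simp_all add: E1_def E2_def E3_def mtrace_avg mtrace_H)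
      (simp add: E_def mtrace_avg[of "\<lambda>a. avg (H a)"] avg_H power2_eq_square *)
qed

lemma mtrace_rel_mat_mult_E:
  assumes "\<And>x f a b. a \<noteq> 0 \<Longrightarrow> b \<noteq> 0 \<Longrightarrow> \<not> R (x, f) (a *s x, b *s f)"
  shows "mtrace (rel_mat R * E1) = 0" "mtrace (rel_mat R * E) = 0"
  by (simp_all add: E_defs avg_mult mtrace_avg mtrace_rel_mat_mult_H[of R, OF assms])

section \<open>The quadratic relations\<close>

lemma quad1: "S1 * S1 = real CARD('k) *\<^sub>R H 1 (-1) + (real CARD('k) - 1) *\<^sub>R (S1 * E1 :: 'k::{field,finite} vec_pair sqmat)"
proof (rule sqmat_eqI)
  let ?q = "CARD('k)"
  fix u v :: "'k vec_pair"
  obtain x f x' p where uv: "u = (x, f)" "v = (x', p)" by (cases u, cases v)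
  have "real ?q - 1 \<noteq> 0" using CARD_field_ge_2[where 'k = 'k] by linarith
  \<comment> \<open>\<open>E1\<close> is moved to the left because \<open>H 1 b * S1\<close> carries
    the scalar \<open>b\<close> itself and \<open>S1 * H 1 b\<close> its inverse.\<close>
  then have "(real ?q - 1) *\<^sub>R (S1 * E1 :: 'k vec_pair sqmat) = (\<Sum>b\<in>UNIV - {0}. H 1 b * S1)"
    unfolding E_S1(1)[symmetric] unfolding E1_def avg_mult by (simp add: avg_def)
  then have "entry ((real ?q - 1) *\<^sub>R (S1 * E1 :: 'k vec_pair sqmat)) u v =
      (\<Sum>b\<in>UNIV - {0}. of_bool (x \<noteq> 0 \<and> x' = x \<and> x = b *s cross f p))"
    by (simp add: entry_sum H_mult_S1 uv)
  also have "\<dots> = card {b. b \<noteq> 0 \<and> x \<noteq> 0 \<and> x' = x \<and> x = b *s cross f p}"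
    by (simp flip: of_bool_conj add: Int_def)
  finally have R: "entry ((real ?q - 1) *\<^sub>R (S1 * E1 :: 'k vec_pair sqmat)) u v =
     card {b. b \<noteq> 0 \<and> x \<noteq> 0 \<and> x' = x \<and> x = b *s cross f p}" .
  \<comment> \<open>Both steps keep \<open>x\<close>, so this counts the \<open>y\<close> with
    \<open>cross f y = x\<close> and \<open>cross y p = x\<close>.\<close>
  have "card {w. step1 u w \<and> step1 w v} = ?q * of_bool (torus_step 1 (-1) u v) +
     card {b. b \<noteq> 0 \<and> x \<noteq> 0 \<and> x' = x \<and> x = b *s cross f p}" (is "card ?L = _ + card ?B")
  proof (cases "x \<noteq> 0 \<and> x' = x")
    case False
    then have "?L = {}" "?B = {}" "\<not> torus_step 1 (-1) u v" by (auto simp: uv)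
    then show ?thesis by (simp only: card.empty) simp
  next
    case True
    show ?thesis
    proof (cases "p = - f")
      \<comment> \<open>For \<open>p = - f\<close> the two equations coincide. Their solutions, if
        any, form a line in direction \<open>f\<close>, hence the term with factor q, while
        \<open>cross f p = 0\<close> excludes every \<open>b\<close>.\<close>
      case p: True
      have B: "?B = {}" using True by (auto simp: p cross_skew[of f "- f"] vec3_eq_iff)
      show ?thesis
      proof (cases "f \<noteq> 0 \<and> dot x f = 0")
        case False
        then have "?L = {}" "\<not> torus_step 1 (-1) u v" using True by (auto simp: uv)
        then show ?thesis using B by (simp only: card.empty) simp
      next
        case f: True
        then obtain y where y: "cross f y = x" using exists_cross_eq by metis
        have "?L = (\<lambda>c. (x, y + c *s f)) ` UNIV"
        proof (intro equalityI subsetI)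
          fix w assume "w \<in> ?L"
          moreover obtain a b where w: "w = (a, b)" by (cases w)
          ultimately have "cross f b = x" and a: "a = x" by (auto simp: uv)
          then have "cross f (b - y) = 0" using y by (simp add: vec3_eq_iff algebra_simps)
          then obtain c where "b - y = c *s f" using cross_eq_0_imp_parallel f by metis
          then have "(a, b) = (x, y + c *s f)" using a by (simp add: algebra_simps)
          then show "w \<in> (\<lambda>c. (x, y + c *s f)) ` UNIV" unfolding w by blast
        next
          fix w assume "w \<in> (\<lambda>c. (x, y + c *s f)) ` UNIV"
          then obtain c where w: "w = (x, y + c *s f)" by blast
          have "cross (y + c *s f) (- f) = cross f y" by (simp add: vec3_eq_iff algebra_simps)
          then have "step1 (x, y + c *s f) v" using y True by (simp add: uv p)
          moreover have "step1 u (x, y + c *s f)"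
            using y True by (simp add: uv cross_add cross_scale)
          ultimately show "w \<in> ?L" unfolding w by blast
        qed
        moreover have "inj (\<lambda>c. (x, y + c *s f))" using f by (auto simp: inj_def)
        ultimately have "card ?L = ?q" by (simp add: card_image)
        moreover have "torus_step 1 (-1) u v" using f True p by (simp add: uv)
        ultimately show ?thesis using B by simp
      qed
    next
      \<comment> \<open>Adding the equations gives \<open>cross y (f + p) = 0\<close>, so
        \<open>y\<close> is a multiple of the nonzero vector \<open>f + p\<close>; the scalar is the
        \<open>b\<close> counted on the other side.\<close>
      case p: False
      have "?L = (\<lambda>b. (x, b *s (f + p))) ` ?B"
      proof (intro equalityI subsetI)
        fix w assume "w \<in> ?L"
        moreover obtain a y where w: "w = (a, y)" by (cases w)
        ultimately have y: "cross f y = x" "cross y p = x" and a: "a = x" by (auto simp: uv)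
        have "y \<noteq> 0" using y True by auto
        moreover have "cross y (f + p) = 0"
          using y cross_skew[of y f] by (simp add: cross_add)
        ultimately obtain d where d: "f + p = d *s y" using cross_eq_0_imp_parallel by metis
        have d0: "d \<noteq> 0"
        proof
          assume "d = 0"
          then have "f + p = 0" using d by simp
          then show False using p by (simp add: add_eq_0_iff)
        qed
        have "y = (1 / d) *s (f + p)" using d d0 by simp
        moreover have "x = (1 / d) *s cross f p"
        proof -
          have "d *s x = cross f (d *s y)" using y by (simp add: cross_scale)
          also have "\<dots> = cross f p" by (simp add: cross_add flip: d)
          finally have "cross f p = d *s x" ..
          then show ?thesis using d0 by simp
        qed
        ultimately show "w \<in> (\<lambda>b. (x, b *s (f + p))) ` ?B"
          using a d0 True unfolding w by (intro image_eqI[of _ _ "1 / d"]) simp_all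
      next
        fix w assume "w \<in> (\<lambda>b. (x, b *s (f + p))) ` ?B"
        then obtain b where b: "x = b *s cross f p" and w: "w = (x, b *s (f + p))" by blast
        have "cross f (b *s (f + p)) = x" "cross (b *s (f + p)) p = x"
          using b by (simp_all add: cross_scale cross_add)
        then show "w \<in> ?L" using True by (simp add: w uv)
      qed
      moreover have "inj_on (\<lambda>b. (x, b *s (f + p))) ?B"
        using p by (auto simp: inj_on_def add_eq_0_iff)
      ultimately have "card ?L = card ?B" by (simp only: card_image)
      moreover have "\<not> torus_step 1 (-1) u v" using p by (simp add: uv)
      ultimately show ?thesis by simp
    qed
  qed
  then show "entry (S1 * S1) u v = entry (real ?q *\<^sub>R H 1 (-1) + (real ?q - 1) *\<^sub>R (S1 * E1 :: 'k vec_pair sqmat)) u v"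
    unfolding plus_sqmat.rep_eq R by (simp add: entry_rel_mat_mult scaleR_sqmat.rep_eq)
qed

lemma quad2: "S2 * S2 = real CARD('k) *\<^sub>R H (-1) 1 + (real CARD('k) - 1) *\<^sub>R (S2 * E2 :: 'k::{field,finite} vec_pair sqmat)"
  using arg_cong[OF quad1[where 'k = 'k], of dual]
  by (simp add: dual_mult dual_S dual_add dual_scaleR dual_H dual_E)

section \<open>Traces of reduced words and the Hecke algebra of flags\<close>

lemma mtrace_words:
  "mtrace (S1 * E1) = 0" "mtrace (S1 * E) = 0" "mtrace (S2 * E) = 0" "mtrace (S1 * (S2 * E)) = 0"
  "mtrace (S2 * (S1 * E)) = 0" "mtrace (S1 * (S2 * (S1 * E))) = 0"
proof -
  \<comment> \<open>No reduced word relates a flag to a rescaling of itself: for the shorter words a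
    cross product of parallel vectors would be nonzero, for the longest one \<open>dot x f'\<close>
    would be both 0 and 1.\<close>
  show "mtrace (S1 * E1) = 0" "mtrace (S1 * E) = 0" "mtrace (S2 * E) = 0"
    by (rule mtrace_rel_mat_mult_E; auto simp: cross_scale)+
  have "mtrace ((S1 * S2) * E) = 0" unfolding S1_mult_S2
    by (rule mtrace_rel_mat_mult_E) (auto simp: cross_scale)
  then show "mtrace (S1 * (S2 * E)) = 0" by (simp add: mult.assoc)
  have "mtrace ((S2 * S1) * E) = 0" unfolding S2_mult_S1
    by (rule mtrace_rel_mat_mult_E) (auto simp: cross_scale)
  then show "mtrace (S2 * (S1 * E)) = 0" by (simp add: mult.assoc)
  have "mtrace ((S1 * (S2 * S1)) * E) = 0" unfolding S1_S2_S1
    by (rule mtrace_rel_mat_mult_E) (auto simp: dot_scale)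
  then show "mtrace (S1 * (S2 * (S1 * E))) = 0" by (simp add: mult.assoc)
qed

lemma H_11_mult: "H 1 1 * S1 = S1" "S1 * H 1 1 = S1" "H 1 1 * S2 = S2" "S2 * H 1 1 = S2"
proof -
  show 1: "S1 * H 1 1 = S1" by (simp add: S1_mult_H) (rule sqmat_eqI, auto)
  then show "S2 * H 1 1 = S2" by (metis dual_H dual_S(1) dual_mult)
  show "H 1 1 * S1 = S1" using 1 by (simp add: H_S1)
  show "H 1 1 * S2 = S2" using \<open>S2 * H 1 1 = S2\<close> by (simp add: H_S2)
qed

lemma E_mult_H_11: "E1 * H 1 1 = E1" "E2 * H 1 1 = E2" "E3 * H 1 1 = E3" "E * H 1 1 = E"
  by (simp_all add: E_defs avg_mult H_mult_H cong: avg_cong)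

interpretation flag: hecke_A2 "S1 :: 'k::{field,finite} vec_pair sqmat" S2 "H 1 1" E1 E2 E3 E
  "H 1 (-1)" "H (-1) 1" "H (-1) (-1)" mtrace "real CARD('k)" "mtrace (H 1 1 :: 'k vec_pair sqmat)"
proof unfold_locales
  show "real CARD('k) \<ge> 2" using CARD_field_ge_2[where 'k = 'k] by simp
qed (rule braid quad1 quad2 H_11_mult E_S1 E_S2 E_idem E_mult E_mult_H_11 mtrace_add mtrace_scaleR
      mtrace_mult_commute mtrace_E mtrace_words refl |
    (simp add: H_mult_H H_S1 H_S2 H_E_commute H_E_absorb H_E_absorb'; fail))+

lemma flag_trace:
  fixes m :: nat
  assumes "m > 0"
  defines "q \<equiv> real CARD('k::{field,finite})"
  defines "f \<equiv> q ^ 3 - q\<^sup>2 - q - 2"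
  shows "mtrace ((S1 * S2 :: 'k vec_pair sqmat) ^ (3 * m)) = q ^ (6 * m) + 3 * f * q ^ (4 * m) +
    (q ^ 5 - 3 * q ^ 4 - 2 * q ^ 3 + 5 * q\<^sup>2 + 9 * q + 6) * q ^ (3 * m) + 3 * f * q ^ (2 * m + 1) + q ^ 3"
  unfolding q_def f_def by (rule flag.tr_power[OF mtrace_H11 assms(1)])

subsection \<open>Normalised lifts\<close>

lemma det_vector_3: "det (vector [a, b, c] :: 'k::field ^ 3 ^ 3) = dot (cross a b) c"
  by (simp add: det_3 vector_3 dot_def algebra_simps)

text \<open>This identity turns the equations of a full step into the value of a
  determinant.\<close>

lemma cross_cross_cross: "cross (cross a b) (cross b c) = dot (cross a b) c *s b"
  by (simp add: vec3_eq_iff dot_def algebra_simps)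

text \<open>Passes from indices starting at 1 to list positions starting at 0.\<close>

lemma cyc_det_Suc: "cyc_det Vs (Suc i) =
    dot (cross (Vs ! (i mod length Vs)) (Vs ! (Suc i mod length Vs))) (Vs ! (Suc (Suc i) mod length Vs))"
  by (simp add: cyc_det_def det_vector_3 cyc_def)

section \<open>Normalised sequences as closed walks\<close>

definition unimodular :: "nat \<Rightarrow> ('k::field ^ 3) list set" where
  "unimodular n = {Vs. length Vs = n \<and> (\<forall>i. cyc_det Vs (Suc i) = 1)}"

definition flag_step :: "'k::field vec_pair \<Rightarrow> 'k vec_pair \<Rightarrow> bool" where
  "flag_step = (\<lambda>(x, f) (x', f'). x \<noteq> 0 \<and> f' \<noteq> 0 \<and> cross f f' = x \<and> cross x x' = f')"

text \<open>Each form is the cross product of the previous and the current vector, so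
  \<open>cross_cross_cross\<close> makes every vector equal to a determinant times itself. The
  second claim gives injectivity later.\<close>

lemma closed_walk_unimodular:
  assumes "n > 0" and us: "us \<in> walks flag_step n" "us ! n = us ! 0"
  shows "map fst (butlast us) \<in> unimodular n"
    "i < n \<Longrightarrow> snd (us ! i) = cross (fst (us ! ((i + n - 1) mod n))) (fst (us ! i))"
proof -
  define x where "x i = fst (us ! (i mod n))" for i
  define f where "f i = snd (us ! (i mod n))" for i
  have len: "length us = Suc n" using us by (simp add: walks_def)
  have step: "flag_step (us ! (i mod n)) (us ! (Suc i mod n))" for i
  proof (cases "Suc (i mod n) = n")
    case True
    then have "Suc i mod n = 0" by (simp add: mod_Suc)
    moreover have "flag_step (us ! (i mod n)) (us ! Suc (i mod n))"
      using us assms(1) by (auto simp: walks_def)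
    ultimately show ?thesis using us True by simp
  next
    case False
    then have "Suc i mod n = Suc (i mod n)" by (simp add: mod_Suc)
    then show ?thesis using us assms(1) by (auto simp: walks_def)
  qed
  have R: "x i \<noteq> 0" "cross (f i) (f (Suc i)) = x i" "cross (x i) (x (Suc i)) = f (Suc i)" for i
    using step[of i] by (auto simp: flag_step_def x_def f_def split: prod.splits)
  have "dot (cross (x i) (x (Suc i))) (x (Suc (Suc i))) = 1" for i
  proof -
    have "dot (cross (x i) (x (Suc i))) (x (Suc (Suc i))) *s x (Suc i) = x (Suc i)"
      by (metis R(2,3) cross_cross_cross)
    then show ?thesis using R(1) by (simp add: smult_eq_self_iff)
  qed
  moreover have "map fst (butlast us) ! (i mod n) = x i" for i
    using len assms(1) by (simp add: x_def nth_butlast)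
  ultimately show "map fst (butlast us) \<in> unimodular n"
    using len by (simp add: unimodular_def cyc_det_Suc)
  show "snd (us ! i) = cross (fst (us ! ((i + n - 1) mod n))) (fst (us ! i))" if "i < n"
    using R(3)[of "i + n - 1"] that assms(1) by (simp add: x_def f_def)
qed

text \<open>The inverse construction: the walk repeats its first pair at the end, and
  \<open>i + n - 1\<close> is the cyclic predecessor without truncation at 0.\<close>

lemma unimodular_closed_walk:
  assumes "n > 0" and Vs: "Vs \<in> unimodular n"
  defines "us \<equiv> map (\<lambda>i. (Vs ! (i mod n), cross (Vs ! ((i + n - 1) mod n)) (Vs ! (i mod n)))) [0..<Suc n]"
  shows "us \<in> walks flag_step n" "us ! n = us ! 0" "map fst (butlast us) = Vs"
proof -
  define x where "x i = Vs ! (i mod n)" for i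
  have len: "length Vs = n" and det: "dot (cross (x i) (x (Suc i))) (x (Suc (Suc i))) = 1" for i
    using Vs by (auto simp: unimodular_def cyc_det_Suc x_def)
  have x_add: "x (i + n) = x i" for i by (simp add: x_def)
  have us: "us ! i = (x i, cross (x (i + n - 1)) (x i))" if "i \<le> n" for i
    unfolding us_def using that by (subst nth_map) (auto simp: x_def nth_append simp del: upt_Suc)
  have nz: "x i \<noteq> 0" "cross (x i) (x (Suc i)) \<noteq> 0" for i
    using det[of i] by auto
  have "flag_step (us ! i) (us ! Suc i)" if "i < n" for i
  proof -
    have "cross (cross (x (i + n - 1)) (x i)) (cross (x i) (x (Suc i))) = x i"
      using det[of "i + n - 1"] assms(1) x_add[of i] x_add[of "Suc i"]
      by (simp add: cross_cross_cross)
    moreover have "x (Suc i + n - 1) = x i" using x_add[of i] by simp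
    ultimately show ?thesis using that nz by (simp add: us flag_step_def)
  qed
  moreover have "length us = Suc n" by (simp add: us_def)
  ultimately show "us \<in> walks flag_step n" by (simp add: walks_def)
  show "us ! n = us ! 0"
    using x_add[of 0] x_add[of "n - 1"] assms(1) by (simp add: us)
  show "map fst (butlast us) = Vs"
    using \<open>length us = Suc n\<close> len by (intro nth_equalityI) (auto simp: nth_butlast us x_def)
qed

lemma card_unimodular:
  assumes "n > 0"
  shows "real (card (unimodular n :: ('k::{field,finite} ^ 3) list set)) = mtrace ((S1 * S2 :: 'k vec_pair sqmat) ^ n)"
proof -
  let ?W = "{us \<in> walks flag_step n. us ! n = us ! 0} :: 'k vec_pair list set"
  have "bij_betw (\<lambda>us. map fst (butlast us)) ?W (unimodular n)"
    unfolding bij_betw_def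
  proof
    show "inj_on (\<lambda>us. map fst (butlast us)) ?W"
    proof (rule inj_onI)
      fix us ws assume us: "us \<in> ?W" and ws: "ws \<in> ?W" and eq: "map fst (butlast us) = map fst (butlast ws)"
      have len: "length us = Suc n" "length ws = Suc n" using us ws by (auto simp: walks_def)
      have fst: "fst (us ! i) = fst (ws ! i)" if "i < n" for i
        using arg_cong[OF eq, of "\<lambda>l. l ! i"] that len by (simp add: nth_butlast)
      have eq': "us ! i = ws ! i" if "i < n" for i
        using closed_walk_unimodular(2)[OF assms, of us i] closed_walk_unimodular(2)[OF assms, of ws i]
          us ws that fst assms by (intro prod_eqI) auto
      show "us = ws"
      proof (rule nth_equalityI)
        fix i assume "i < length us"
        then show "us ! i = ws ! i"
          using us ws eq'[of 0] eq'[of i] assms len by (cases "i = n") auto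
      qed (simp add: len)
    qed
    show "(\<lambda>us. map fst (butlast us)) ` ?W = unimodular n"
      using closed_walk_unimodular(1)[OF assms] unimodular_closed_walk[OF assms] by (force intro!: image_eqI)
  qed
  then have "card (unimodular n :: ('k ^ 3) list set) = card ?W" by (simp add: bij_betw_same_card)
  then show ?thesis
    unfolding S1_mult_S2 using mtrace_rel_mat_power[of "flag_step :: 'k vec_pair \<Rightarrow> _" n]
    by (simp add: flag_step_def)
qed

section \<open>Independence as nonvanishing of determinants\<close>

lemma in_proj_plane_eq_span:
  assumes "p \<in> proj_plane" "is_lift V p"
  shows "p = vec.span {V}"
proof
  have "V \<in> p" "V \<noteq> 0" "vec.subspace p" using assms by (auto simp: is_lift_def proj_plane_def)
  then show "vec.span {V} \<subseteq> p" by (simp add: vec.span_minimal)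
  show "p \<subseteq> vec.span {V}"
    using assms \<open>V \<in> p\<close> \<open>V \<noteq> 0\<close> by (intro vec.card_ge_dim_independent) (auto simp: proj_plane_def)
qed

lemma span_singleton_lift:
  assumes "V \<noteq> 0"
  shows "vec.span {V} \<in> proj_plane" "is_lift V (vec.span {V})"
  using assms by (auto simp: proj_plane_def is_lift_def vec.span_base vec.dim_eq_card_independent)

lemma independent_iff_det:
  fixes a b c :: "'k::field ^ 3"
  shows "distinct [a, b, c] \<and> vec.independent (set [a, b, c]) \<longleftrightarrow> dot (cross a b) c \<noteq> 0"
proof
  assume nz: "dot (cross a b) c \<noteq> 0"
  have "rows (vector [a, b, c] :: 'k ^ 3 ^ 3) = {a, b, c}"
  proof -
    have "rows A = range (vec_nth A)" for A :: "'k ^ 3 ^ 3"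
      by (auto simp: rows_def row_def vec_nth_inverse)
    then show ?thesis by (auto simp: UNIV_3 vector_3)
  qed
  then have "vec.independent {a, b, c}"
    using det_dependent_rows[of "vector [a, b, c] :: 'k ^ 3 ^ 3"] nz by (auto simp: det_vector_3)
  then show "distinct [a, b, c] \<and> vec.independent (set [a, b, c])"
    using nz by auto
next
  assume ind: "distinct [a, b, c] \<and> vec.independent (set [a, b, c])"
  show "dot (cross a b) c \<noteq> 0"
  proof
    assume 0: "dot (cross a b) c = 0"
    have a0: "a \<noteq> 0" using ind vec.dependent_zero[of "{a, b, c}"] by auto
    show False
    proof (cases "cross a b = 0")
      case True
      then obtain k where "b = k *s a" using cross_eq_0_imp_parallel a0 by metis
      moreover have "a \<in> {a, b, c} - {b}" using ind by auto
      ultimately have "b \<in> vec.span ({a, b, c} - {b})"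
        by (metis vec.span_base vec.span_scale)
      then show False using ind unfolding vec.dependent_def by simp
    next
      case False
      then obtain z where z: "dot (cross a b) z = 1" using exists_dot_1 by blast
      \<comment> \<open>Cramer's rule for four vectors in dimension three; with vanishing
        determinant it expresses \<open>c\<close> through \<open>a\<close> and
        \<open>b\<close>.\<close>
      have "dot (cross a b) z *s c = dot (cross c b) z *s a + dot (cross a c) z *s b + dot (cross a b) c *s z"
        by (simp add: vec3_eq_iff dot_def algebra_simps)
      then have "c = dot (cross c b) z *s a + dot (cross a c) z *s b" using z 0 by simp
      moreover have "a \<in> {a, b, c} - {c}" "b \<in> {a, b, c} - {c}" using ind by auto
      ultimately have "c \<in> vec.span ({a, b, c} - {c})"
        by (metis vec.span_add vec.span_scale vec.span_base)
      then show False using ind unfolding vec.dependent_def by simp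
    qed
  qed
qed

lemma proj_independent_iff_det:
  assumes "{p1, p2, p3} \<subseteq> proj_plane" "is_lift a p1" "is_lift b p2" "is_lift c p3"
  shows "proj_independent [p1, p2, p3] \<longleftrightarrow> dot (cross a b) c \<noteq> 0"
  using proj_independent_iff[of "[p1, p2, p3]" "[a, b, c]"] assms independent_iff_det[of a b c] by simp

lemma C3_iff_cyc_det:
  assumes "n > 0" "length vs = n" "set vs \<subseteq> proj_plane" "list_all2 is_lift Vs vs"
  shows "vs \<in> C3 n \<longleftrightarrow> (\<forall>i. cyc_det Vs (Suc i) \<noteq> 0)"
proof -
  have len: "length Vs = n" using assms by (auto dest: list_all2_lengthD)
  have "is_lift (Vs ! (i mod n)) (vs ! (i mod n))" "vs ! (i mod n) \<in> proj_plane" for i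
    using assms by (auto simp: list_all2_conv_all_nth)
  then have *: "proj_independent [cyc vs (Suc i), cyc vs (Suc i + 1), cyc vs (Suc i + 2)] \<longleftrightarrow> cyc_det Vs (Suc i) \<noteq> 0" for i
    unfolding cyc_det_Suc len using assms(2) by (simp add: cyc_def proj_independent_iff_det)
  have "cyc_det Vs (Suc i) = cyc_det Vs (Suc (i mod n))" for i
    unfolding cyc_det_Suc len by (simp add: mod_Suc_eq mod_simps)
  then have "(\<forall>i. cyc_det Vs (Suc i) \<noteq> 0) \<longleftrightarrow> (\<forall>i<n. cyc_det Vs (Suc i) \<noteq> 0)"
    using assms(1) by (metis mod_less_divisor)
  also have "\<dots> \<longleftrightarrow> (\<forall>i\<in>{1..n}. proj_independent [cyc vs i, cyc vs (i + 1), cyc vs (i + 2)])"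
    unfolding *[symmetric] by (simp only: image_Suc_lessThan[symmetric] ball_simps lessThan_iff Ball_def) blast
  finally show ?thesis using assms by (simp add: C3_def)
qed

text \<open>The unique scaling of the lifts, given its first two values, that turns every \<open>d i\<close> into \<open>1\<close>.\<close>

fun scale_seq :: "(nat \<Rightarrow> 'k::field) \<Rightarrow> 'k \<Rightarrow> 'k \<Rightarrow> nat \<Rightarrow> 'k" where
  "scale_seq d a b 0 = a"
| "scale_seq d a b (Suc 0) = b"
| "scale_seq d a b (Suc (Suc i)) = 1 / (d i * scale_seq d a b i * scale_seq d a b (Suc i))"

lemma scale_seq_unique:
  assumes "\<And>i. t i * t (Suc i) * t (Suc (Suc i)) * d i = 1"
  shows "t i = scale_seq d (t 0) (t 1) i"
proof -
  have "t i = scale_seq d (t 0) (t 1) i \<and> t (Suc i) = scale_seq d (t 0) (t 1) (Suc i)"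
  proof (induction i)
    case (Suc i)
    have "t (Suc (Suc i)) * (d i * t i * t (Suc i)) = 1" using assms[of i] by (simp add: algebra_simps)
    then have "t (Suc (Suc i)) = 1 / (d i * t i * t (Suc i))"
      by (metis eq_divide_imp mult_zero_right zero_neq_one)
    then show ?case using Suc by simp
  qed simp
  then show ?thesis ..
qed

context
  fixes d :: "nat \<Rightarrow> 'k::field" and a b :: 'k
  assumes d: "\<And>i. d i \<noteq> 0" and a: "a \<noteq> 0" and b: "b \<noteq> 0"
begin

lemma scale_seq_nonzero: "scale_seq d a b i \<noteq> 0"
  using d a b by (induction d a b i rule: scale_seq.induct) auto

lemma scale_seq_mult: "scale_seq d a b i * scale_seq d a b (Suc i) * scale_seq d a b (Suc (Suc i)) * d i = 1"
  using scale_seq_nonzero[of i] scale_seq_nonzero[of "Suc i"] d[of i] by simp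

text \<open>Two consecutive normalisation equations share two scalars, which cancel.\<close>

lemma scale_seq_add_3: "scale_seq d a b (i + 3) * d (Suc i) = scale_seq d a b i * d i"
proof -
  let ?s = "scale_seq d a b"
  have "?s (Suc i) * ?s (Suc (Suc i)) * (?s (i + 3) * d (Suc i)) = ?s (Suc i) * ?s (Suc (Suc i)) * (?s i * d i)"
    using scale_seq_mult[of i] scale_seq_mult[of "Suc i"] by (simp add: algebra_simps numeral_3_eq_3 del: scale_seq.simps)
  then show ?thesis using scale_seq_nonzero[of "Suc i"] scale_seq_nonzero[of "Suc (Suc i)"] by (simp del: scale_seq.simps)
qed

lemma scale_seq_add_3_mult:
  "scale_seq d a b (i + 3 * k) * (\<Prod>j<k. d (Suc i + 3 * j)) = scale_seq d a b i * (\<Prod>j<k. d (i + 3 * j))"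
proof (induction k)
  case (Suc k)
  have "scale_seq d a b (i + 3 * Suc k) * d (Suc (i + 3 * k)) = scale_seq d a b (i + 3 * k) * d (i + 3 * k)"
    using scale_seq_add_3[of "i + 3 * k"] by (simp add: algebra_simps)
  then have "scale_seq d a b (i + 3 * Suc k) * ((\<Prod>j<k. d (Suc i + 3 * j)) * d (Suc i + 3 * k)) =
      (scale_seq d a b (i + 3 * k) * (\<Prod>j<k. d (Suc i + 3 * j))) * d (i + 3 * k)"
    by (simp add: ac_simps)
  then show ?case unfolding Suc.IH prod.lessThan_Suc by (simp only: mult.assoc)
qed simp

text \<open>By telescoping, the two balance conditions say that positions 0 and 1 recur after
  \<open>3 * m\<close> steps; the second-order recursion with periodic \<open>d\<close> carries this
  to all positions.\<close>

lemma scale_seq_periodic: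
  assumes per: "\<And>i. d (i + 3 * m) = d i"
    and bal: "(\<Prod>j<m. d (3 * j)) = (\<Prod>j<m. d (1 + 3 * j))" "(\<Prod>j<m. d (1 + 3 * j)) = (\<Prod>j<m. d (2 + 3 * j))"
  shows "scale_seq d a b (i + 3 * m) = scale_seq d a b i"
proof -
  have nz: "(\<Prod>j<m. d (i + 3 * j)) \<noteq> 0" for i using d by simp
  have "scale_seq d a b (i + 3 * m) = scale_seq d a b i \<and> scale_seq d a b (Suc i + 3 * m) = scale_seq d a b (Suc i)"
  proof (induction i)
    case 0
    show ?case
      using scale_seq_add_3_mult[of 0 m] scale_seq_add_3_mult[of 1 m] bal nz[of 1] nz[of 2] by (simp add: d)
  next
    case (Suc i)
    then show ?case using per[of i] by simp
  qed
  then show ?thesis ..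
qed

end

section \<open>Counting the normalised lifts of a tuple\<close>

lemma cyc_det_scale:
  assumes "length Ws = length Vs" "\<And>i. Ws ! (i mod length Vs) = t i *s Vs ! (i mod length Vs)"
  shows "cyc_det Ws (Suc i) = t i * t (Suc i) * t (Suc (Suc i)) * cyc_det Vs (Suc i)"
  by (simp add: cyc_det_Suc assms cross_scale dot_scale)

lemma card_unimodular_lifts:
  fixes vs :: "('k::{field,finite} ^ 3) set list"
  assumes n: "3 dvd n" "n > 0" and vs: "vs \<in> C3_star n"
  shows "card {Vs \<in> unimodular n. list_all2 is_lift Vs vs} = (CARD('k) - 1) ^ 2"
proof -
  define m where "m = n div 3"
  have m: "n = 3 * m" "m > 0" using n by (auto simp: m_def)
  from vs have C3: "vs \<in> C3 n" and pp: "set vs \<subseteq> proj_plane" and len_vs: "length vs = n"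
    by (auto simp: C3_star_def C3_def)
  from vs obtain Vs where Vs: "list_all2 is_lift Vs vs" and bal: "balanced Vs"
    by (auto simp: C3_star_def)
  have len: "length Vs = n" using Vs len_vs by (auto dest: list_all2_lengthD)
  define d where "d i = cyc_det Vs (Suc i)" for i
  have d: "d i \<noteq> 0" for i
    using C3_iff_cyc_det[OF n(2) len_vs pp Vs] C3 by (simp add: d_def)
  have per: "d (i + 3 * m) = d i" for i
  proof -
    have *: "(k + n) mod n = k mod n" for k by simp
    show ?thesis
      unfolding d_def cyc_det_Suc len m(1)[symmetric] by (simp only: * add_Suc[symmetric])
  qed
  have bal: "(\<Prod>j<m. d (3 * j)) = (\<Prod>j<m. d (1 + 3 * j))" "(\<Prod>j<m. d (1 + 3 * j)) = (\<Prod>j<m. d (2 + 3 * j))"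
  proof -
    note bal = bal[unfolded balanced_def len m_def[symmetric]]
    show "(\<Prod>j<m. d (3 * j)) = (\<Prod>j<m. d (1 + 3 * j))"
      using bspec[OF bal, of 1] by (simp add: d_def numeral_3_eq_3)
    show "(\<Prod>j<m. d (1 + 3 * j)) = (\<Prod>j<m. d (2 + 3 * j))"
      using bspec[OF bal, of 2] by (simp add: d_def numeral_3_eq_3)
  qed
  have lift: "is_lift (Vs ! i) (vs ! i)" "vs ! i \<in> proj_plane" "Vs ! i \<noteq> 0" if "i < n" for i
    using that Vs len_vs pp by (auto simp: list_all2_conv_all_nth is_lift_def)
  let ?U = "UNIV - {0 :: 'k}"
  let ?F = "{Vs \<in> unimodular n. list_all2 is_lift Vs vs}"
  \<comment> \<open>The first two scalars are free and all others are forced, hence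
    \<open>(CARD('k) - 1) ^ 2\<close> lifts.\<close>
  define W where "W a b = map (\<lambda>i. scale_seq d a b i *s Vs ! i) [0..<n]" for a b
  have "bij_betw (\<lambda>(a, b). W a b) (?U \<times> ?U) ?F"
    unfolding bij_betw_def
  proof
    have n2: "0 < n" "1 < n" using m by auto
    show "inj_on (\<lambda>(a, b). W a b) (?U \<times> ?U)"
    proof (rule inj_onI)
      fix p p' assume eq: "(case p of (a, b) \<Rightarrow> W a b) = (case p' of (a, b) \<Rightarrow> W a b)"
      obtain a b a' b' where p: "p = (a, b)" "p' = (a', b')" by (metis surj_pair)
      have "W a b ! 0 = W a' b' ! 0" "W a b ! 1 = W a' b' ! 1" using eq by (simp_all add: p)
      then show "p = p'" using n2 lift(3)[of 0] lift(3)[of 1] by (simp add: W_def p)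
    qed
    show "(\<lambda>(a, b). W a b) ` (?U \<times> ?U) = ?F"
    proof (intro equalityI subsetI)
      fix Ws assume "Ws \<in> (\<lambda>(a, b). W a b) ` (?U \<times> ?U)"
      then obtain a b where ab: "a \<noteq> 0" "b \<noteq> 0" and Ws: "Ws = W a b" by auto
      \<comment> \<open>Determinants read positions modulo \<open>n\<close>, whereas
        \<open>scale_seq\<close> runs on; periodicity makes the wrap-around determinants equal to 1
        as well.\<close>
      have period: "scale_seq d a b (i mod n) = scale_seq d a b i" for i
      proof (induction i rule: less_induct)
        case (less i)
        show ?case
        proof (cases "i < n")
          case False
          then have "scale_seq d a b (i mod n) = scale_seq d a b ((i - n) mod n)" by (simp add: le_mod_geq)
          also have "\<dots> = scale_seq d a b (i - n)" using False n by (intro less.IH) simp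
          also have "\<dots> = scale_seq d a b i"
            using scale_seq_periodic[where d = d and a = a and b = b, OF d ab per bal, of "i - n"] False m by simp
          finally show ?thesis .
        qed simp
      qed
      have "cyc_det Ws (Suc i) = scale_seq d a b i * scale_seq d a b (Suc i) * scale_seq d a b (Suc (Suc i)) * d i" for i
        unfolding d_def[of i] using n by (intro cyc_det_scale) (simp_all add: Ws W_def len period)
      then have "Ws \<in> unimodular n"
        using scale_seq_mult[where d = d and a = a and b = b, OF d ab] by (simp add: unimodular_def Ws W_def del: scale_seq.simps)
      moreover have "list_all2 is_lift Ws vs"
        using scale_seq_nonzero[where d = d and a = a and b = b, OF d ab] lift(1,2)
        by (auto simp: list_all2_conv_all_nth Ws W_def len_vs is_lift_def proj_plane_def vec.subspace_scale)
      ultimately show "Ws \<in> ?F" by simp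
    next
      fix Ws assume "Ws \<in> ?F"
      then have Ws: "length Ws = n" "\<And>i. cyc_det Ws (Suc i) = 1" "list_all2 is_lift Ws vs"
        by (auto simp: unimodular_def)
      obtain c where c: "\<And>k. k < n \<Longrightarrow> c k \<noteq> 0 \<and> Ws ! k = c k *s (Vs ! k)"
        using lifts_scale[OF pp Vs Ws(3)] len_vs by blast
      \<comment> \<open>Any normalised lift rescales \<open>Vs\<close>; its scalars, extended
        periodically, satisfy the recursion and are fixed by the first two.\<close>
      define t where "t i = c (i mod n)" for i
      have "t i * t (Suc i) * t (Suc (Suc i)) * d i = 1" for i
        unfolding d_def using cyc_det_scale[of Ws Vs t i] Ws(1,2) c n by (simp add: len t_def)
      then have t: "t i = scale_seq d (t 0) (t 1) i" for i by (rule scale_seq_unique)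
      have "Ws = W (t 0) (t 1)"
      proof (rule nth_equalityI)
        fix i assume "i < length Ws"
        then show "Ws ! i = W (t 0) (t 1) ! i" using c t[of i] Ws(1) by (simp add: W_def t_def)
      qed (simp add: Ws W_def)
      moreover have "t 0 \<noteq> 0" "t 1 \<noteq> 0" using c n by (auto simp: t_def)
      ultimately show "Ws \<in> (\<lambda>(a, b). W a b) ` (?U \<times> ?U)" by auto
    qed
  qed
  from bij_betw_same_card[OF this] show ?thesis by (simp add: card_cartesian_product card_Diff_singleton power2_eq_square)
qed

lemma unimodular_lift:
  assumes "3 dvd n" "n > 0" and Vs: "Vs \<in> unimodular n"
  shows "map (\<lambda>V. vec.span {V}) Vs \<in> C3_star n" "list_all2 is_lift Vs (map (\<lambda>V. vec.span {V}) Vs)"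
proof -
  let ?vs = "map (\<lambda>V. vec.span {V}) Vs"
  have len: "length Vs = n" and det: "cyc_det Vs (Suc i) = 1" for i
    using Vs by (auto simp: unimodular_def)
  have "Vs ! i \<noteq> 0" if "i < n" for i
    using det[of i] that by (auto simp: cyc_det_Suc len)
  then have nz: "V \<noteq> 0" if "V \<in> set Vs" for V
    using that len by (metis in_set_conv_nth)
  show lift: "list_all2 is_lift Vs ?vs"
    using nz span_singleton_lift(2) nth_mem by (auto simp: list_all2_conv_all_nth)
  have pp: "set ?vs \<subseteq> proj_plane" using nz span_singleton_lift by auto
  have "?vs \<in> C3 n" using C3_iff_cyc_det[OF assms(2) _ pp lift] det len by simp
  moreover have "balanced Vs" using det by (auto simp: balanced_def)
  ultimately show "?vs \<in> C3_star n" using lift by (auto simp: C3_star_def)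
qed

lemma card_unimodular_eq:
  assumes n: "3 dvd n" "n > 0"
  shows "card (unimodular n :: ('k::{field,finite} ^ 3) list set) =
    card (C3_star n :: ('k ^ 3) set list set) * (CARD('k) - 1) ^ 2"
proof -
  let ?F = "\<lambda>vs. {Vs \<in> unimodular n. list_all2 is_lift Vs vs} :: ('k ^ 3) list set"
  have fin: "finite (C3_star n :: ('k ^ 3) set list set)" "finite (unimodular n :: ('k ^ 3) list set)"
    by (rule finite_subset[OF _ finite_lists_length_eq[of UNIV n]]; auto simp: C3_star_def C3_def unimodular_def)+
  have eq: "vs = map (\<lambda>V. vec.span {V}) Vs" if "vs \<in> C3_star n" "list_all2 is_lift Vs vs" for vs and Vs :: "('k ^ 3) list"
  proof (rule nth_equalityI)
    show "length vs = length (map (\<lambda>V. vec.span {V}) Vs)" using that by (auto dest: list_all2_lengthD)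
    fix i assume "i < length vs"
    then show "vs ! i = map (\<lambda>V. vec.span {V}) Vs ! i"
      using that in_proj_plane_eq_span[of "vs ! i" "Vs ! i"] nth_mem[of i vs]
      by (simp add: list_all2_conv_all_nth C3_star_def C3_def subset_iff)
  qed
  \<comment> \<open>Each normalised sequence lifts exactly one tuple, its list of spans, so the
    union is disjoint.\<close>
  have "unimodular n = (\<Union>vs\<in>C3_star n. ?F vs)"
    using unimodular_lift[OF n] by blast
  then have "card (unimodular n :: ('k ^ 3) list set) = card (\<Union>vs\<in>C3_star n. ?F vs)" by simp
  also have "\<dots> = (\<Sum>vs\<in>C3_star n. card (?F vs))"
    using fin eq by (intro card_UN_disjoint) (auto intro: finite_subset)
  also have "\<dots> = card (C3_star n :: ('k ^ 3) set list set) * (CARD('k) - 1) ^ 2"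
    by (simp add: card_unimodular_lifts[OF n])
  finally show ?thesis .
qed

theorem theorem4p3:
  fixes n :: nat
  assumes "3 dvd n" and "n > 0"
  shows "let q = real CARD('k::{field,finite});
             f = q ^ 3 - q ^ 2 - q - 2
         in real (card (C3_star n :: ('k ^ 3) set list set)) =
            (q ^ (2 * n) + 3 * f * q ^ (4 * (n div 3))
             + (q ^ 5 - 3 * q ^ 4 - 2 * q ^ 3 + 5 * q ^ 2 + 9 * q + 6) * q ^ n
             + 3 * f * q ^ (2 * (n div 3) + 1) + q ^ 3) / (q - 1) ^ 2"
proof -
  obtain m where m: "n = 3 * m" "m > 0" using assms by (auto elim: dvdE)
  have q: "real (CARD('k) - 1) = real CARD('k) - 1" "real CARD('k) - 1 \<noteq> 0"
    using CARD_field_ge_2[where 'k = 'k] by (simp_all add: of_nat_diff)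
  have "real (card (C3_star n :: ('k ^ 3) set list set)) * (real CARD('k) - 1) ^ 2 =
      mtrace ((S1 * S2 :: 'k vec_pair sqmat) ^ n)"
    using card_unimodular[OF assms(2), where 'k = 'k] card_unimodular_eq[OF assms, where 'k = 'k]
    by (simp only: of_nat_mult of_nat_power q(1))
  then have "real (card (C3_star n :: ('k ^ 3) set list set)) =
      mtrace ((S1 * S2 :: 'k vec_pair sqmat) ^ n) / (real CARD('k) - 1) ^ 2"
    using q(2) by (simp add: nonzero_eq_divide_eq)
  then show ?thesis
    unfolding Let_def m(1) flag_trace[OF m(2)] by simp
qed

end
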